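(* Let $L \ge 3$ be odd and let $\mathcal{G}$ be the cycle graph of length $L$, with initial tile weights $w \equiv 1$ and constant vertex density $\alpha \in \left(0, \frac{L-1}{L}\right)$ at each of the vertices $v_1, \dots, v_L$. There exists a unique vertex density $\hat\alpha \in \left(0,\frac{L-1}{L}\right)$ for which the critical tile distribution is uniform (that is, for which the critical weight function $w'_\alpha$ with $\alpha = \hat\alpha$ takes the same value on all tiles), and $$\hat\alpha = 1 - \frac{(\varphi^L - \psi^L)/\sqrt5}{\varphi^L + \psi^L}.$$ Furthermore, $\hat\alpha$ is the unique density in $\left(0,\frac{L-1}{L}\right)$ which maximizes the exponential growth rate $\sigma(\alpha)$.
   Context: $\varphi = \frac{1+\sqrt5}{2}$ and $\psi = \frac{1-\sqrt5}{2}$. Graph and tiles. $\mathcal{G}$ has vertices $v_1,\dots,v_L$ and edges $v_1v_2, \dots, v_{L-1}v_L, v_Lv_1$. A partial matching of $\mathcal{G}$ is a subset of edges (possibly empty) covering each vertex at most once. The set of tiles $T$ is the set of all partial matchings. For $t\in T$, $s(t)$ is the number of edges of $t$; for $i=1,\dots,L$, $t_{v_i}\in\{0,1\}$ is $1$ iff $t$ covers $v_i$. An additional vertex $v_0$ is introduced (with no edges), which each tile $t$ contains with multiplicity $t_{v_0} = L - 2s(t)$. The tiling polynomial is $P(x_0,\dots,x_L) = \sum_{t\in T} \prod_{i=0}^{L} x_i^{t_{v_i}}$ (initial weights all equal to $1$), homogeneous of degree $L$. Densities. The prescribed densities are $\alpha_{v_i} = \alpha$ for $i=1,\dots,L$ and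 $\alpha_{v_0} = L(1-\alpha)$; the feasible range is $\alpha\in(0,\frac{L-1}{L})$. Critical weights. Two weight functions $w, w': T\to\mathbb{R}_{>0}$ are gauge equivalent if there is $f:\{v_0,\dots,v_L\}\to\mathbb{R}_{>0}$ with $w'(t) = w(t)\prod_{i=0}^L f(v_i)^{t_{v_i}}$ for all $t$. For each feasible $\alpha$ there is a unique weight function $w'_\alpha$ gauge equivalent to $w\equiv 1$ such that $\sum_{t\in T} t_{v_i} w'_\alpha(t) = \alpha_{v_i}$ for all $i = 0,\dots,L$ (known result of Kenyon and Pohoata); it is called the critical weight function. It satisfies $\sum_t w'_\alpha(t) = 1$, and the resulting probability distribution on $T$ is the critical tile distribution. Growth rate. For $N\ge1$ and multiplicities $\mathbf{n} = (n_{v_1},\dots,n_{v_L})\in(\mathbb{Z}_{\ge0})^L$, a colored $\mathbf{n}$-multiweb is a map $m:[N]\to T$ such that each vertex $v_i$, $1\le i\le L$, is covered exactly $n_{v_i}$ times in total, i.e. $\sum_{k=1}^N m(k)_{v_i} = n_{v_i}$. Let $Z_{\mathbf{n},N}$ be the number of these (the partition function for $w\equiv1$). The exponential growth rate is $$\sigma(\alpha) = \lim \frac1N\log Z_{\mathbf{n},N},$$ the limit being taken as $N\to\infty$ along $\mathbf{n}$ with $Z_{\mathbf{n},N}>0$ and $n_{v_i}/N\to\alpha$ for all $i=1,\dots,L$. It is known that this limit exists and equals $\log P(\mathrm{x}) - \sum_{i=0}^L \alpha_{v_i}\log \mathrm{x}_i$ for any positive solution $\mathrm{x} = (\mathrm{x}_0,\dots,\mathrm{x}_L)$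 of the equations $\frac{x_i\,\partial_{x_i}P}{P} = \alpha_{v_i}$, $i=0,\dots,L$ (a positive solution always exists). *)

theory Defs
  imports Complex_Main "HOL-Library.FuncSet"
begin

text \<open>The vertex \<open>v\<^sub>i\<close> is the number \<open>i\<close>: the cycle lives on \<open>{1..L}\<close>, and \<open>0\<close> is the additional
  isolated vertex \<open>v\<^sub>0\<close>. An edge is the set of its two end points, so the definitions describe
  the cycle graph only for \<open>L \<ge> 3\<close>.\<close>

definition cycle_edges :: "nat \<Rightarrow> nat set set" where
  "cycle_edges L = insert {L, 1} ((\<lambda>i. {i, i + 1}) ` {1..<L})"

definition tiles :: "nat \<Rightarrow> nat set set set" where
  "tiles L = {t. t \<subseteq> cycle_edges L \<and> (\<forall>v. card {e \<in> t. v \<in> e} \<le> 1)}"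

text \<open>The truncated subtraction is harmless: a partial matching has at most \<open>L / 2\<close> edges.\<close>

definition tile_mult :: "nat \<Rightarrow> nat set set \<Rightarrow> nat \<Rightarrow> nat" where
  "tile_mult L t i = (if i = 0 then L - 2 * card t else if i \<in> \<Union>t then 1 else 0)"

definition density :: "nat \<Rightarrow> real \<Rightarrow> nat \<Rightarrow> real" where
  "density L \<alpha> i = (if i = 0 then real L * (1 - \<alpha>) else \<alpha>)"

definition feasible_densities :: "nat \<Rightarrow> real set" where
  "feasible_densities L = {0<..<(real L - 1) / real L}"

definition gauge_equivalent ::
    "nat \<Rightarrow> (nat set set \<Rightarrow> real) \<Rightarrow> (nat set set \<Rightarrow> real) \<Rightarrow> bool" where
  "gauge_equivalent L w w' \<longleftrightarrow>
    (\<exists>f :: nat \<Rightarrow> real. (\<forall>i\<in>{0..L}. 0 < f i) \<and>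
      (\<forall>t\<in>tiles L. w' t = w t * (\<Prod>i=0..L. f i ^ tile_mult L t i)))"

text \<open>Weight functions are elements of the extensional function space \<open>T \<rightarrow>\<^sub>E {0<..}\<close>, so that
  the description below picks out a single HOL function: existence and uniqueness of the critical
  weight function on \<open>T\<close>, for every feasible density, is a result of Kenyon and Pohoata.\<close>

definition is_critical_weight :: "nat \<Rightarrow> real \<Rightarrow> (nat set set \<Rightarrow> real) \<Rightarrow> bool" where
  "is_critical_weight L \<alpha> w' \<longleftrightarrow>
    w' \<in> tiles L \<rightarrow>\<^sub>E {0<..} \<and>
    gauge_equivalent L (\<lambda>_. 1) w' \<and>
    (\<forall>i\<in>{0..L}. (\<Sum>t\<in>tiles L. real (tile_mult L t i) * w' t) = density L \<alpha> i)"

definition critical_weight :: "nat \<Rightarrow> real \<Rightarrow> nat set set \<Rightarrow> real" where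
  "critical_weight L \<alpha> = (THE w'. is_critical_weight L \<alpha> w')"

definition critical_distribution_uniform :: "nat \<Rightarrow> real \<Rightarrow> bool" where
  "critical_distribution_uniform L \<alpha> \<longleftrightarrow>
    (\<exists>c. \<forall>t\<in>tiles L. critical_weight L \<alpha> t = c)"

definition multiwebs :: "nat \<Rightarrow> nat \<Rightarrow> (nat \<Rightarrow> nat) \<Rightarrow> (nat \<Rightarrow> nat set set) set" where
  "multiwebs L N n =
    {m \<in> {1..N} \<rightarrow>\<^sub>E tiles L. \<forall>i\<in>{1..L}. (\<Sum>k=1..N. tile_mult L (m k) i) = n i}"

definition partition_function :: "nat \<Rightarrow> nat \<Rightarrow> (nat \<Rightarrow> nat) \<Rightarrow> nat" where
  "partition_function L N n = card (multiwebs L N n)"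

text \<open>Filter on pairs \<open>(N, n)\<close> expressing \<open>N \<rightarrow> \<infinity>\<close> and \<open>n\<^sub>i / N \<rightarrow> \<alpha>\<close> for \<open>1 \<le> i \<le> L\<close>, along pairs
  that admit at least one multiweb. The values of \<open>n\<close> outside \<open>{1..L}\<close> play no role.\<close>

definition growth_filter :: "nat \<Rightarrow> real \<Rightarrow> (nat \<times> (nat \<Rightarrow> nat)) filter" where
  "growth_filter L \<alpha> =
    inf (inf (filtercomap fst at_top)
             (INF i\<in>{1..L}. filtercomap (\<lambda>(N, n). real (n i) / real N) (nhds \<alpha>)))
        (principal {(N, n). 0 < partition_function L N n})"

definition growth_rate :: "nat \<Rightarrow> real \<Rightarrow> real" where
  "growth_rate L \<alpha> =
    Lim (growth_filter L \<alpha>) (\<lambda>(N, n). ln (real (partition_function L N n)) / real N)"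

definition golden_phi :: real where
  "golden_phi = (1 + sqrt 5) / 2"

definition golden_psi :: real where
  "golden_psi = (1 - sqrt 5) / 2"

end

theory Submission
  imports Defs "HOL-Number_Theory.Fib"
begin

text \<open>Give every tile with \<open>s\<close> edges the weight \<open>y ^ s\<close>. By rotation symmetry all vertices of the
  cycle then have the same density, and by the intermediate value theorem every feasible \<open>\<alpha>\<close> is
  attained by some \<open>y > 0\<close>; normalising gives the critical weight, which is uniform iff \<open>y = 1\<close>.
  Counting matchings of the cycle by Fibonacci numbers yields the density for \<open>y = 1\<close>.

  The growth rate equals the entropy of the critical distribution. The upper bound is the
  generating function bound \<open>Z * y ^ S \<le> (\<Sum>t. y ^ s t) ^ N\<close>, where \<open>S\<close> is the number of edges
  used. For the lower bound, by a Chernoff estimate the typical sequences of length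
  \<open>M = (1 - \<epsilon>) N\<close> drawn from the critical distribution number about \<open>exp (M * entropy)\<close> and have
  vertex counts close to \<open>M \<alpha>\<close>; each of them is completed by \<open>N - M\<close> further tiles to a multiweb
  with exactly the prescribed counts. This
  completion uses that on an odd cycle vertex counts with an even sum determine integral edge
  multiplicities. Finally, entropy is at most \<open>ln |T|\<close>, with equality only for the
  uniform distribution.\<close>

section \<open>Typical sequences\<close>

text \<open>For negative \<open>x = - u\<close> the bound comes from
  \<open>(1 - u + u^2) * (1 + u) = 1 + u^3 \<ge> 1\<close> and
  \<open>1 + u \<le> exp u\<close>.\<close>

lemma exp_le_quadratic:
  fixes x :: real
  assumes "\<bar>x\<bar> \<le> 1"
  shows "exp x \<le> 1 + x + x\<^sup>2"
proof (cases "0 \<le> x")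
  case True
  then show ?thesis using assms exp_bound[of x] by simp
next
  case False
  define u where "u = - x"
  have u: "0 < u" using False by (simp add: u_def)
  have "1 \<le> (1 - u + u\<^sup>2) * (1 + u)"
    using u by (simp add: power2_eq_square algebra_simps)
  also have "\<dots> \<le> (1 - u + u\<^sup>2) * exp u"
  proof (rule mult_left_mono)
    have "0 \<le> (1 - u)\<^sup>2 + u" using u by simp
    then show "0 \<le> 1 - u + u\<^sup>2" by (simp add: power2_eq_square algebra_simps)
  qed (use exp_ge_add_one_self in auto)
  finally have "exp (- u) \<le> 1 - u + u\<^sup>2"
    by (simp add: exp_minus field_simps)
  then show ?thesis by (simp add: u_def)
qed

lemma sum_PiE_prod_const:
  fixes g :: "'a \<Rightarrow> real"
  assumes "finite A" "finite T"
  shows "(\<Sum>m\<in>A \<rightarrow>\<^sub>E T. \<Prod>k\<in>A. g (m k)) = (\<Sum>t\<in>T. g t) ^ card A"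
  using prod_sum_PiE[of A "\<lambda>_. T" "\<lambda>_. g"] assms by simp

text \<open>Exponential Markov inequality: under the product weight the exponential of the sum
  factorises over the positions, and each centred factor has mean at most
  \<open>1 + l^2 \<le> exp (l^2)\<close>.\<close>

lemma chernoff_upper_tail:
  fixes w X :: "'a \<Rightarrow> real" and \<delta> :: real
  assumes T: "finite T" and A: "finite A"
    and w: "\<And>t. t \<in> T \<Longrightarrow> 0 \<le> w t" "(\<Sum>t\<in>T. w t) = 1"
    and X: "\<And>t. t \<in> T \<Longrightarrow> \<bar>X t\<bar> \<le> 1" "(\<Sum>t\<in>T. w t * X t) = 0"
    and \<delta>: "0 \<le> \<delta>" "\<delta> \<le> 2"
  shows "(\<Sum>m | m \<in> A \<rightarrow>\<^sub>E T \<and> \<delta> * real (card A) \<le> (\<Sum>k\<in>A. X (m k)). \<Prod>k\<in>A. w (m k))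
    \<le> exp (- \<delta>\<^sup>2 / 4 * real (card A))"
proof -
  \<comment> \<open>The minimiser of \<open>l^2 - l * \<delta>\<close>;
    \<open>\<delta> \<le> 2\<close> keeps \<open>l * X t\<close> in the range of the quadratic bound
    on \<open>exp\<close>.\<close>
  define l where "l = \<delta> / 2"
  have l: "0 \<le> l" "l \<le> 1" using \<delta> by (auto simp: l_def)
  let ?B = "{m. m \<in> A \<rightarrow>\<^sub>E T \<and> \<delta> * real (card A) \<le> (\<Sum>k\<in>A. X (m k))}"
  have fin: "finite (A \<rightarrow>\<^sub>E T)" by (intro finite_PiE A T)
  have wm: "0 \<le> (\<Prod>k\<in>A. w (m k))" if "m \<in> A \<rightarrow>\<^sub>E T" for m
    using that w(1) by (intro prod_nonneg) auto
  have "(\<Sum>m\<in>?B. \<Prod>k\<in>A. w (m k)) * exp (l * \<delta> * real (card A))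
      \<le> (\<Sum>m\<in>?B. (\<Prod>k\<in>A. w (m k)) * exp (l * (\<Sum>k\<in>A. X (m k))))"
    unfolding sum_distrib_right
    by (intro sum_mono mult_left_mono) (use l wm in \<open>auto simp: mult.assoc intro: mult_left_mono\<close>)
  also have "\<dots> \<le> (\<Sum>m\<in>A \<rightarrow>\<^sub>E T. (\<Prod>k\<in>A. w (m k)) * exp (l * (\<Sum>k\<in>A. X (m k))))"
    using fin wm by (intro sum_mono2) auto
  also have "\<dots> = (\<Sum>m\<in>A \<rightarrow>\<^sub>E T. \<Prod>k\<in>A. w (m k) * exp (l * X (m k)))"
    by (simp add: sum_distrib_left exp_sum A prod.distrib)
  also have "\<dots> = (\<Sum>t\<in>T. w t * exp (l * X t)) ^ card A"
    by (rule sum_PiE_prod_const[OF A T])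
  also have "\<dots> \<le> exp (l\<^sup>2) ^ card A"
  proof (rule power_mono)
    have "(\<Sum>t\<in>T. w t * exp (l * X t)) \<le> (\<Sum>t\<in>T. w t * (1 + l * X t + l\<^sup>2))"
    proof (intro sum_mono mult_left_mono w(1))
      fix t assume t: "t \<in> T"
      have le: "\<bar>l * X t\<bar> \<le> 1" using l X(1)[OF t] by (simp add: abs_mult mult_le_one)
      have "(X t)\<^sup>2 \<le> 1" using X(1)[OF t] by (simp add: abs_square_le_1)
      then have "(l * X t)\<^sup>2 \<le> l\<^sup>2" by (simp add: power_mult_distrib mult_left_le)
      then show "exp (l * X t) \<le> 1 + l * X t + l\<^sup>2" using exp_le_quadratic[OF le] by simp
    qed
    also have "\<dots> = (\<Sum>t\<in>T. w t) * (1 + l\<^sup>2) + l * (\<Sum>t\<in>T. w t * X t)"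
      by (simp add: sum_distrib_left sum_distrib_right sum.distrib algebra_simps)
    also have "\<dots> \<le> exp (l\<^sup>2)" by (simp add: w(2) X(2))
    finally show "(\<Sum>t\<in>T. w t * exp (l * X t)) \<le> exp (l\<^sup>2)" .
    show "0 \<le> (\<Sum>t\<in>T. w t * exp (l * X t))" using w(1) by (intro sum_nonneg) auto
  qed
  also have "\<dots> = exp (l\<^sup>2 * card A)"
    by (simp add: exp_of_nat_mult[symmetric] mult.commute)
  finally have "(\<Sum>m\<in>?B. \<Prod>k\<in>A. w (m k)) \<le> exp (l\<^sup>2 * card A) / exp (l * \<delta> * real (card A))"
    by (simp add: field_simps)
  also have "\<dots> = exp (- \<delta>\<^sup>2 / 4 * real (card A))"
    by (simp add: exp_diff[symmetric] l_def power2_eq_square algebra_simps)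
  finally show ?thesis by simp
qed

text \<open>Union bound: a sequence outside the set lies in one of the two tails of some
  \<open>X i\<close>, the lower tail being the upper tail of \<open>- X i\<close>.\<close>

lemma typical_weight_ge:
  fixes w :: "'a \<Rightarrow> real" and X :: "'i \<Rightarrow> 'a \<Rightarrow> real" and \<delta> :: real
  assumes T: "finite T" and A: "finite A" and I: "finite I"
    and w: "\<And>t. t \<in> T \<Longrightarrow> 0 \<le> w t" "(\<Sum>t\<in>T. w t) = 1"
    and X: "\<And>i t. i \<in> I \<Longrightarrow> t \<in> T \<Longrightarrow> \<bar>X i t\<bar> \<le> 1" "\<And>i. i \<in> I \<Longrightarrow> (\<Sum>t\<in>T. w t * X i t) = 0"
    and \<delta>: "0 \<le> \<delta>" "\<delta> \<le> 2"
  shows "1 - 2 * real (card I) * exp (- \<delta>\<^sup>2 / 4 * real (card A))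
    \<le> (\<Sum>m | m \<in> A \<rightarrow>\<^sub>E T \<and> (\<forall>i\<in>I. \<bar>\<Sum>k\<in>A. X i (m k)\<bar> \<le> \<delta> * real (card A)). \<Prod>k\<in>A. w (m k))"
proof -
  let ?G = "{m. m \<in> A \<rightarrow>\<^sub>E T \<and> (\<forall>i\<in>I. \<bar>\<Sum>k\<in>A. X i (m k)\<bar> \<le> \<delta> * real (card A))}"
  let ?U = "\<lambda>Y :: 'a \<Rightarrow> real. {m. m \<in> A \<rightarrow>\<^sub>E T \<and> \<delta> * real (card A) \<le> (\<Sum>k\<in>A. Y (m k))}"
  let ?W = "\<lambda>m. \<Prod>k\<in>A. w (m k)"
  let ?e = "exp (- \<delta>\<^sup>2 / 4 * real (card A))"
  have fin: "finite (A \<rightarrow>\<^sub>E T)" by (intro finite_PiE A T)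
  have wm: "0 \<le> ?W m" if "m \<in> A \<rightarrow>\<^sub>E T" for m
    using that w(1) by (intro prod_nonneg) auto
  have finU: "finite (?U Y)" for Y using fin by (rule rev_finite_subset) auto
  have finG: "finite ?G" using fin by (rule rev_finite_subset) auto
  have tails: "sum ?W (?U (X i) \<union> ?U (\<lambda>t. - X i t)) \<le> 2 * ?e" if i: "i \<in> I" for i
  proof -
    have "sum ?W (?U (X i) \<union> ?U (\<lambda>t. - X i t)) + sum ?W (?U (X i) \<inter> ?U (\<lambda>t. - X i t))
        = sum ?W (?U (X i)) + sum ?W (?U (\<lambda>t. - X i t))"
      by (intro sum.union_inter finU)
    moreover have "0 \<le> sum ?W (?U (X i) \<inter> ?U (\<lambda>t. - X i t))"
      using wm by (intro sum_nonneg) auto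
    moreover have "sum ?W (?U (X i)) \<le> ?e"
      using X i by (intro chernoff_upper_tail T A w \<delta>) auto
    moreover have "sum ?W (?U (\<lambda>t. - X i t)) \<le> ?e"
      using X i by (intro chernoff_upper_tail T A w \<delta>) (auto simp: sum_negf)
    ultimately show ?thesis by linarith
  qed
  have "A \<rightarrow>\<^sub>E T \<subseteq> ?G \<union> (\<Union>i\<in>I. ?U (X i) \<union> ?U (\<lambda>t. - X i t))"
    by (force simp: sum_negf abs_le_iff)
  then have "sum ?W (A \<rightarrow>\<^sub>E T) \<le> sum ?W (?G \<union> (\<Union>i\<in>I. ?U (X i) \<union> ?U (\<lambda>t. - X i t)))"
    using wm finG finU I by (intro sum_mono2) auto
  also have "\<dots> \<le> sum ?W ?G + sum ?W (\<Union>i\<in>I. ?U (X i) \<union> ?U (\<lambda>t. - X i t))"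
  proof -
    let ?V = "\<Union>i\<in>I. ?U (X i) \<union> ?U (\<lambda>t. - X i t)"
    have "sum ?W (?G \<union> ?V) + sum ?W (?G \<inter> ?V) = sum ?W ?G + sum ?W ?V"
      using finG finU I by (intro sum.union_inter) auto
    moreover have "0 \<le> sum ?W (?G \<inter> ?V)" using wm by (intro sum_nonneg) auto
    ultimately show ?thesis by linarith
  qed
  also have "sum ?W (\<Union>i\<in>I. ?U (X i) \<union> ?U (\<lambda>t. - X i t))
      \<le> (\<Sum>i\<in>I. sum ?W (?U (X i) \<union> ?U (\<lambda>t. - X i t)))"
    using I finU
  proof (induction I)
    case (insert i I)
    let ?V = "\<lambda>i. ?U (X i) \<union> ?U (\<lambda>t. - X i t)"
    have "sum ?W (?V i \<union> (\<Union>i\<in>I. ?V i)) + sum ?W (?V i \<inter> (\<Union>i\<in>I. ?V i))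
        = sum ?W (?V i) + sum ?W (\<Union>i\<in>I. ?V i)"
      using insert finU by (intro sum.union_inter) auto
    moreover have "0 \<le> sum ?W (?V i \<inter> (\<Union>i\<in>I. ?V i))"
      using wm by (intro sum_nonneg) auto
    ultimately show ?case using insert by simp
  qed simp
  also have "\<dots> \<le> (\<Sum>i\<in>I. 2 * ?e)" by (intro sum_mono tails)
  finally show ?thesis
    using sum_PiE_prod_const[OF A T, of w] by (simp add: w(2))
qed

section \<open>Tiles as sets of edge numbers\<close>

text \<open>Edge \<open>0\<close> closes the cycle, so that two edges meet iff their numbers are cyclically consecutive.\<close>

definition cycle_edge :: "nat \<Rightarrow> nat \<Rightarrow> nat set" where
  "cycle_edge L j = (if j = 0 then {L, 1} else {j, j + 1})"

definition cyclic_matchings :: "nat \<Rightarrow> nat set set" where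
  "cyclic_matchings L = {J. J \<subseteq> {0..<L} \<and> (\<forall>j\<in>J. Suc j mod L \<notin> J)}"

definition tile_of :: "nat \<Rightarrow> nat set \<Rightarrow> nat set set" where
  "tile_of L J = cycle_edge L ` J"

lemma finite_cyclic_matchings: "finite (cyclic_matchings L)"
  by (rule finite_subset[of _ "Pow {0..<L}"]) (auto simp: cyclic_matchings_def)

lemma Suc_mod_eq: "j < L \<Longrightarrow> Suc j mod L = (if Suc j = L then 0 else Suc j)"
  by auto

context
  fixes L :: nat
  assumes L3: "3 \<le> L"
begin

lemma cycle_edges_eq: "cycle_edges L = cycle_edge L ` {0..<L}"
proof -
  have "{0..<L} = insert 0 {1..<L}" using L3 by auto
  then show ?thesis by (auto simp: cycle_edges_def cycle_edge_def)
qed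

lemma inj_on_cycle_edge: "inj_on (cycle_edge L) {0..<L}"
proof (rule inj_onI)
  fix i j assume "cycle_edge L i = cycle_edge L j"
  then show "i = j"
    using L3 unfolding cycle_edge_def by (auto simp only: doubleton_eq_iff split: if_splits)
qed

text \<open>The edge following vertex \<open>L\<close> is the closing edge \<open>0\<close>, so
  \<open>v mod L\<close> names the following edge uniformly. Vertex \<open>0\<close> must be
  excluded by \<open>1 \<le> v\<close>, because \<open>v - 1\<close> and \<open>v mod L\<close>
  would both be \<open>0\<close> there.\<close>

lemma mem_cycle_edge_iff:
  assumes "j < L"
  shows "v \<in> cycle_edge L j \<longleftrightarrow> 1 \<le> v \<and> v \<le> L \<and> (j = v - 1 \<or> j = v mod L)"
proof -
  consider "v < L" | "v = L" | "L < v" by linarith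
  then show ?thesis
    by cases (use assms L3 in \<open>auto simp: cycle_edge_def\<close>)
qed

lemma incident_edges:
  assumes "J \<subseteq> {0..<L}"
  shows "{e \<in> tile_of L J. v \<in> e}
    = cycle_edge L ` {j \<in> J. 1 \<le> v \<and> v \<le> L \<and> (j = v - 1 \<or> j = v mod L)}"
proof -
  have "v \<in> cycle_edge L j \<longleftrightarrow> 1 \<le> v \<and> v \<le> L \<and> (j = v - 1 \<or> j = v mod L)" if "j \<in> J" for j
    using assms that by (intro mem_cycle_edge_iff) auto
  then show ?thesis unfolding tile_of_def by blast
qed

text \<open>Only two edges can be incident with a vertex, so the degree condition forbids exactly
  the pairs of cyclically consecutive numbers.\<close>

lemma tile_of_in_tiles_iff:
  assumes J: "J \<subseteq> {0..<L}"
  shows "tile_of L J \<in> tiles L \<longleftrightarrow> J \<in> cyclic_matchings L"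
proof -
  let ?I = "\<lambda>v. {j \<in> J. 1 \<le> v \<and> v \<le> L \<and> (j = v - 1 \<or> j = v mod L)}"
  have fJ: "finite J" using J by (rule finite_subset) simp
  have sub: "tile_of L J \<subseteq> cycle_edges L"
    using J by (auto simp: tile_of_def cycle_edges_eq)
  have card: "card {e \<in> tile_of L J. v \<in> e} = card (?I v)" for v
    unfolding incident_edges[OF J]
    by (intro card_image inj_on_subset[OF inj_on_cycle_edge]) (use J in auto)
  have "(\<forall>v. card (?I v) \<le> 1) \<longleftrightarrow> (\<forall>j\<in>J. Suc j mod L \<notin> J)"
  proof (intro iffI ballI allI)
    fix j assume le: "\<forall>v. card (?I v) \<le> 1" and j: "j \<in> J"
    have jL: "j < L" using j J by auto
    show "Suc j mod L \<notin> J"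
    proof
      assume "Suc j mod L \<in> J"
      \<comment> \<open>Both edges meet at vertex \<open>Suc j\<close>, which would then be covered
        twice.\<close>
      then have "{j, Suc j mod L} \<subseteq> ?I (Suc j)" using j jL by auto
      then have "card {j, Suc j mod L} \<le> card (?I (Suc j))" using fJ by (intro card_mono) auto
      moreover have "j \<noteq> Suc j mod L" using jL L3 by (auto simp: Suc_mod_eq)
      ultimately show False using le by (auto dest: spec[of _ "Suc j"])
    qed
  next
    fix v assume mat: "\<forall>j\<in>J. Suc j mod L \<notin> J"
    have eq: "x = y" if "x \<in> ?I v" "y \<in> ?I v" for x y
      using that mat by (auto dest!: bspec[of _ _ "v - 1"])
    have "finite (?I v)" using fJ by simp
    then have "card (?I v) \<le> Suc 0 \<longleftrightarrow> (\<forall>x\<in>?I v. \<forall>y\<in>?I v. x = y)"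
      by (rule card_le_Suc0_iff_eq)
    moreover have "\<forall>x\<in>?I v. \<forall>y\<in>?I v. x = y" by (intro ballI eq)
    ultimately have "card (?I v) \<le> Suc 0" by (rule iffD2)
    then show "card (?I v) \<le> 1" by (simp only: One_nat_def)
  qed
  then show ?thesis
    using sub J by (simp add: tiles_def cyclic_matchings_def card)
qed

lemma bij_betw_tile_of: "bij_betw (tile_of L) (cyclic_matchings L) (tiles L)"
proof (rule bij_betw_imageI)
  show "inj_on (tile_of L) (cyclic_matchings L)"
    unfolding tile_of_def
    using inj_on_image_eq_iff[OF inj_on_cycle_edge]
    by (auto simp: inj_on_def cyclic_matchings_def)
  show "tile_of L ` cyclic_matchings L = tiles L"
  proof
    show "tile_of L ` cyclic_matchings L \<subseteq> tiles L"
      using tile_of_in_tiles_iff by (auto simp: cyclic_matchings_def)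
    show "tiles L \<subseteq> tile_of L ` cyclic_matchings L"
    proof
      fix t assume t: "t \<in> tiles L"
      then have "t \<subseteq> cycle_edge L ` {0..<L}" by (simp add: tiles_def cycle_edges_eq)
      then obtain J where "J \<subseteq> {0..<L}" "t = tile_of L J"
        by (auto simp: subset_image_iff tile_of_def)
      then show "t \<in> tile_of L ` cyclic_matchings L" using t tile_of_in_tiles_iff by auto
    qed
  qed
qed

lemma tiles_eq: "tiles L = tile_of L ` cyclic_matchings L"
  using bij_betw_tile_of by (simp add: bij_betw_def)

lemma finite_tiles: "finite (tiles L)"
  by (simp add: tiles_eq finite_cyclic_matchings)

lemma sum_tiles:
  fixes g :: "nat set set \<Rightarrow> 'a :: comm_monoid_add"
  shows "(\<Sum>t\<in>tiles L. g t) = (\<Sum>J\<in>cyclic_matchings L. g (tile_of L J))"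
  by (rule sum.reindex_bij_betw[OF bij_betw_tile_of, symmetric])

lemma card_tile_of:
  assumes "J \<in> cyclic_matchings L"
  shows "card (tile_of L J) = card J"
  unfolding tile_of_def using assms
  by (intro card_image inj_on_subset[OF inj_on_cycle_edge]) (auto simp: cyclic_matchings_def)

text \<open>A matching contains at most one of the two edges at \<open>v\<close>, so the indicator
  of being covered is the sum of their indicators. This makes vertex counts linear in edge
  multiplicities.\<close>

lemma tile_mult_tile_of:
  assumes J: "J \<in> cyclic_matchings L" and v: "v \<in> {1..L}"
  shows "tile_mult L (tile_of L J) v = of_bool (v - 1 \<in> J) + of_bool (v mod L \<in> J)"
proof -
  have JL: "J \<subseteq> {0..<L}" using J by (simp add: cyclic_matchings_def)
  have "v \<in> \<Union> (tile_of L J) \<longleftrightarrow> (\<exists>j\<in>J. v \<in> cycle_edge L j)" by (auto simp: tile_of_def)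
  also have "\<dots> \<longleftrightarrow> v - 1 \<in> J \<or> v mod L \<in> J"
  proof -
    have "v \<in> cycle_edge L j \<longleftrightarrow> j = v - 1 \<or> j = v mod L" if "j \<in> J" for j
      using JL that v by (subst mem_cycle_edge_iff) auto
    then show ?thesis by blast
  qed
  moreover have "\<not> (v - 1 \<in> J \<and> v mod L \<in> J)"
    using J v by (auto simp: cyclic_matchings_def dest!: bspec[of _ _ "v - 1"])
  ultimately show ?thesis using v by (auto simp: tile_mult_def)
qed

text \<open>Double counting of incidences: \<open>v - 1\<close> and \<open>v mod L\<close> each run
  through all edges once.\<close>

lemma sum_vertices_eq:
  fixes c :: "nat \<Rightarrow> 'a :: comm_semiring_1"
  shows "(\<Sum>v=1..L. c (v - 1) + c (v mod L)) = 2 * (\<Sum>j<L. c j)"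
proof -
  have "(\<Sum>v=1..L. c (v - 1)) = (\<Sum>j<L. c j)"
    by (rule sum.reindex_bij_witness[of _ Suc "\<lambda>v. v - 1"]) auto
  moreover have "(\<Sum>v=1..L. c (v mod L)) = (\<Sum>j<L. c j)"
    by (rule sum.reindex_bij_witness[of _ "\<lambda>j. if j = 0 then L else j" "\<lambda>v. v mod L"])
      (use L3 in \<open>auto simp: le_less\<close>)
  ultimately show ?thesis by (simp add: sum.distrib mult_2)
qed

lemma sum_tile_mult:
  assumes t: "t \<in> tiles L"
  shows "(\<Sum>v=1..L. tile_mult L t v) = 2 * card t"
proof -
  obtain J where J: "J \<in> cyclic_matchings L" and tJ: "t = tile_of L J"
    using t by (auto simp: tiles_eq)
  have "(\<Sum>v=1..L. tile_mult L t v)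
      = (\<Sum>v=1..L. of_bool (v - 1 \<in> J) + of_bool (v mod L \<in> J))"
    using J by (intro sum.cong) (auto simp: tJ tile_mult_tile_of)
  also have "\<dots> = 2 * (\<Sum>j<L. of_bool (j \<in> J))"
    by (rule sum_vertices_eq)
  also have "(\<Sum>j<L. of_bool (j \<in> J)) = card ({..<L} \<inter> J)"
    by (simp add: of_bool_def sum.If_cases)
  also have "{..<L} \<inter> J = J" using J by (auto simp: cyclic_matchings_def)
  finally show ?thesis using J by (simp add: tJ card_tile_of)
qed

lemma card_tile_le:
  assumes "t \<in> tiles L"
  shows "2 * card t \<le> L"
proof -
  have "(\<Sum>v=1..L. tile_mult L t v) \<le> (\<Sum>v=1..L. 1)"
    by (intro sum_mono) (auto simp: tile_mult_def)
  then show ?thesis using sum_tile_mult[OF assms] by simp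
qed

lemma empty_in_tiles: "{} \<in> tiles L"
  by (simp add: tiles_def)

text \<open>Together with the empty tile this gives two tiles whose numbers of edges differ by one;
  equality of their weights forces \<open>y = 1\<close>.\<close>

lemma singleton_in_tiles: "{{1, 2}} \<in> tiles L"
proof -
  have "{1} \<in> cyclic_matchings L" using L3 by (auto simp: cyclic_matchings_def)
  moreover have "tile_of L {1} = {{1, 2}}"
    by (simp add: tile_of_def cycle_edge_def numeral_2_eq_2)
  ultimately show ?thesis by (auto simp: tiles_eq)
qed

section \<open>Rotation symmetry of the cycle\<close>

lemma rotate_cyclic_matching:
  assumes J: "J \<in> cyclic_matchings L"
  shows "(\<lambda>j. Suc j mod L) ` J \<in> cyclic_matchings L"
proof -
  have inj: "inj_on (\<lambda>j. Suc j mod L) {0..<L}"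
    by (auto simp: inj_on_def Suc_mod_eq split: if_splits)
  show ?thesis
    unfolding cyclic_matchings_def
  proof (intro CollectI conjI ballI notI)
    show "(\<lambda>j. Suc j mod L) ` J \<subseteq> {0..<L}" using L3 by auto
    fix j assume "j \<in> (\<lambda>j. Suc j mod L) ` J" "Suc j mod L \<in> (\<lambda>j. Suc j mod L) ` J"
    then obtain a b where ab: "a \<in> J" "b \<in> J" "j = Suc a mod L" "Suc j mod L = Suc b mod L"
      by auto
    have "b < L" "j < L" using ab(2,3) J L3 by (auto simp: cyclic_matchings_def)
    then have "j = b" by (intro inj_onD[OF inj ab(4)]) simp_all
    then show False using ab(1-3) J by (auto simp: cyclic_matchings_def)
  qed
qed

lemma bij_betw_rotate:
  "bij_betw ((`) (\<lambda>j. Suc j mod L)) (cyclic_matchings L) (cyclic_matchings L)"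
proof -
  have inj: "inj_on (\<lambda>j. Suc j mod L) {0..<L}"
    by (auto simp: inj_on_def Suc_mod_eq split: if_splits)
  have "inj_on ((`) (\<lambda>j. Suc j mod L)) (cyclic_matchings L)"
    using inj_on_image_eq_iff[OF inj] by (auto simp: inj_on_def cyclic_matchings_def)
  moreover have "(`) (\<lambda>j. Suc j mod L) ` cyclic_matchings L = cyclic_matchings L"
    by (rule endo_inj_surj) (use calculation rotate_cyclic_matching finite_cyclic_matchings in auto)
  ultimately show ?thesis by (simp add: bij_betw_def)
qed

text \<open>Rotation by one step maps the matchings through \<open>j\<close> onto those through
  \<open>Suc j\<close> and preserves the number of edges.\<close>

lemma sum_edge_rotate:
  fixes g :: "nat \<Rightarrow> 'a :: comm_monoid_add"
  assumes "j < L"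
  shows "(\<Sum>J | J \<in> cyclic_matchings L \<and> j \<in> J. g (card J))
    = (\<Sum>J | J \<in> cyclic_matchings L \<and> 0 \<in> J. g (card J))"
  using assms
proof (induction j)
  case (Suc j)
  let ?r = "\<lambda>j. Suc j mod L"
  have inj: "inj_on ?r {0..<L}"
    by (auto simp: inj_on_def Suc_mod_eq split: if_splits)
  have mem: "Suc j \<in> ?r ` J \<longleftrightarrow> j \<in> J" if J: "J \<in> cyclic_matchings L" for J
    using Suc.prems J inj_on_image_mem_iff[OF inj, of j J]
    by (auto simp: cyclic_matchings_def)
  have "(\<Sum>J | J \<in> cyclic_matchings L \<and> Suc j \<in> J. g (card J))
      = (\<Sum>J\<in>cyclic_matchings L. if Suc j \<in> J then g (card J) else 0)"
    by (simp add: sum.inter_filter finite_cyclic_matchings)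
  also have "\<dots> = (\<Sum>J\<in>cyclic_matchings L. if Suc j \<in> ?r ` J then g (card (?r ` J)) else 0)"
    by (rule sum.reindex_bij_betw[OF bij_betw_rotate, symmetric])
  also have "\<dots> = (\<Sum>J\<in>cyclic_matchings L. if j \<in> J then g (card J) else 0)"
  proof (rule sum.cong)
    fix J assume J: "J \<in> cyclic_matchings L"
    have "card (?r ` J) = card J"
      by (intro card_image inj_on_subset[OF inj]) (use J in \<open>auto simp: cyclic_matchings_def\<close>)
    then show "(if Suc j \<in> ?r ` J then g (card (?r ` J)) else 0)
        = (if j \<in> J then g (card J) else 0)" by (simp add: mem[OF J])
  qed simp
  also have "\<dots> = (\<Sum>J | J \<in> cyclic_matchings L \<and> j \<in> J. g (card J))"
    by (simp add: sum.inter_filter finite_cyclic_matchings)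
  finally show ?case using Suc by simp
qed simp

lemma sum_tile_mult_const:
  fixes g :: "nat \<Rightarrow> real"
  assumes v: "v \<in> {1..L}"
  shows "(\<Sum>t\<in>tiles L. real (tile_mult L t v) * g (card t))
    = 2 * (\<Sum>J | J \<in> cyclic_matchings L \<and> 0 \<in> J. g (card J))"
proof -
  have "(\<Sum>t\<in>tiles L. real (tile_mult L t v) * g (card t))
      = (\<Sum>J\<in>cyclic_matchings L. (if v - 1 \<in> J then g (card J) else 0)
          + (if v mod L \<in> J then g (card J) else 0))"
    unfolding sum_tiles using v
    by (intro sum.cong) (auto simp: tile_mult_tile_of card_tile_of)
  also have "\<dots> = (\<Sum>J | J \<in> cyclic_matchings L \<and> v - 1 \<in> J. g (card J))
      + (\<Sum>J | J \<in> cyclic_matchings L \<and> v mod L \<in> J. g (card J))"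
    by (simp add: sum.distrib sum.inter_filter finite_cyclic_matchings)
  also have "\<dots> = 2 * (\<Sum>J | J \<in> cyclic_matchings L \<and> 0 \<in> J. g (card J))"
    using sum_edge_rotate[of "v - 1" g] sum_edge_rotate[of "v mod L" g] v by auto
  finally show ?thesis .
qed

text \<open>By symmetry all \<open>L\<close> vertices contribute equally, and summing over them
  counts every edge of a tile twice. Conditions on the vertex densities thus reduce to a single
  condition on the mean number of edges.\<close>

lemma sum_tile_mult_eq_average:
  fixes g :: "nat \<Rightarrow> real"
  assumes v: "v \<in> {1..L}"
  shows "real L * (\<Sum>t\<in>tiles L. real (tile_mult L t v) * g (card t))
    = (\<Sum>t\<in>tiles L. 2 * real (card t) * g (card t))"
proof -
  have "real L * (\<Sum>t\<in>tiles L. real (tile_mult L t v) * g (card t))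
      = (\<Sum>u=1..L. \<Sum>t\<in>tiles L. real (tile_mult L t u) * g (card t))"
    using v by (subst sum.cong[OF refl sum_tile_mult_const]) (auto simp: sum_tile_mult_const)
  also have "\<dots> = (\<Sum>t\<in>tiles L. real (\<Sum>u=1..L. tile_mult L t u) * g (card t))"
    by (subst sum.swap) (simp add: sum_distrib_right)
  also have "\<dots> = (\<Sum>t\<in>tiles L. 2 * real (card t) * g (card t))"
    by (intro sum.cong refl, subst sum_tile_mult) simp_all
  finally show ?thesis .
qed

end

section \<open>Counting tiles\<close>

text \<open>The matchings of a path with \<open>n\<close> edges. The offset \<open>a\<close> serves
  the path left over around a chosen edge of the cycle, whose numbering starts at
  \<open>1\<close>.\<close>

definition path_matchings :: "nat \<Rightarrow> nat \<Rightarrow> nat set set" where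
  "path_matchings a n = {J. J \<subseteq> {a..<a + n} \<and> (\<forall>j\<in>J. Suc j \<notin> J)}"

lemma finite_path_matchings: "finite (path_matchings a n)"
  by (rule finite_subset[of _ "Pow {a..<a + n}"]) (auto simp: path_matchings_def)

text \<open>Fibonacci recursion by the last edge: if it is used, its neighbour is not and a path
  with two edges fewer remains; otherwise a path with one edge fewer remains.\<close>

lemma card_path_matchings: "card (path_matchings a n) = fib (Suc (Suc n))"
proof (induction n rule: fib.induct)
  case 1
  have "path_matchings a 0 = {{}}" by (auto simp: path_matchings_def)
  then show ?case by simp
next
  case 2
  have "path_matchings a (Suc 0) = {{}, {a}}"
    by (auto simp: path_matchings_def subset_singleton_iff)
  then show ?case by simp
next
  case (3 n)
  let ?b = "a + Suc n"
  have notin: "?b \<notin> J" if "J \<in> path_matchings a n" for J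
    using that by (auto simp: path_matchings_def)
  have "path_matchings a (Suc (Suc n)) = path_matchings a (Suc n) \<union> insert ?b ` path_matchings a n"
    (is "?A = ?B \<union> ?C")
  proof (intro equalityI subsetI)
    fix J assume J: "J \<in> ?A"
    have JL: "x < a + Suc (Suc n)" "a \<le> x" "Suc x \<notin> J" if "x \<in> J" for x
      using J that by (auto simp: path_matchings_def)
    show "J \<in> ?B \<union> ?C"
    proof (cases "?b \<in> J")
      case True
      have "x < a + n" if x: "x \<in> J - {?b}" for x
      proof -
        have "x \<noteq> a + n" using JL(3)[of x] True x by auto
        then show ?thesis using JL(1)[of x] x by auto
      qed
      then have "J - {?b} \<in> path_matchings a n"
        using JL by (simp add: path_matchings_def subset_iff)
      moreover have "J = insert ?b (J - {?b})" using True by auto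
      ultimately show ?thesis by blast
    next
      case False
      have "x < a + Suc n" if x: "x \<in> J" for x
        using JL(1)[OF x] x False by (cases "x = ?b") auto
      then have "J \<in> ?B" using JL by (auto simp: path_matchings_def)
      then show ?thesis by simp
    qed
  next
    fix J assume "J \<in> ?B \<union> ?C"
    then show "J \<in> ?A" by (force simp: path_matchings_def)
  qed
  moreover have "?B \<inter> ?C = {}" by (auto simp: path_matchings_def)
  moreover have "card ?C = card (path_matchings a n)"
    by (intro card_image inj_onI) (use notin in \<open>metis insert_ident\<close>)
  ultimately show ?case
    using 3 by (simp add: card_Un_disjoint finite_path_matchings)
qed

context
  fixes L :: nat
  assumes L3: "3 \<le> L"
begin

lemma cyclic_matchings_without_last:
  "{J. J \<in> cyclic_matchings L \<and> L - 1 \<notin> J} = path_matchings 0 (L - 1)"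
proof (intro equalityI subsetI)
  fix J assume "J \<in> {J. J \<in> cyclic_matchings L \<and> L - 1 \<notin> J}"
  then have J: "J \<subseteq> {0..<L}" "\<forall>j\<in>J. Suc j mod L \<notin> J" "L - 1 \<notin> J"
    by (auto simp: cyclic_matchings_def)
  have lt: "j < L - 1" if "j \<in> J" for j
    using J that by (cases "j = L - 1") auto
  have "Suc j \<notin> J" if "j \<in> J" for j
    using J(2) lt[OF that] that by (auto simp: Suc_mod_eq dest!: bspec[of _ _ j])
  then show "J \<in> path_matchings 0 (L - 1)" using lt by (auto simp: path_matchings_def)
next
  fix J assume "J \<in> path_matchings 0 (L - 1)"
  then have J: "J \<subseteq> {0..<L - 1}" "\<forall>j\<in>J. Suc j \<notin> J" by (auto simp: path_matchings_def)
  have "Suc j mod L \<notin> J" if "j \<in> J" for j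
    using J that by (auto simp: Suc_mod_eq)
  then show "J \<in> {J. J \<in> cyclic_matchings L \<and> L - 1 \<notin> J}"
    using J by (auto simp: cyclic_matchings_def)
qed

text \<open>Using edge \<open>L - 1\<close> excludes its neighbours \<open>0\<close> and
  \<open>L - 2\<close>, which leaves the path of the edges \<open>1\<close> to
  \<open>L - 3\<close>.\<close>

lemma cyclic_matchings_with_last:
  "{J. J \<in> cyclic_matchings L \<and> L - 1 \<in> J} = insert (L - 1) ` path_matchings 1 (L - 3)"
proof (intro equalityI subsetI)
  fix J assume "J \<in> {J. J \<in> cyclic_matchings L \<and> L - 1 \<in> J}"
  then have J: "J \<subseteq> {0..<L}" "\<And>j. j \<in> J \<Longrightarrow> Suc j mod L \<notin> J" "L - 1 \<in> J"
    by (auto simp: cyclic_matchings_def)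
  have rng: "1 \<le> j \<and> j < L - 2" if j: "j \<in> J" "j \<noteq> L - 1" for j
  proof -
    have "j \<noteq> 0" using J(2)[OF J(3)] L3 j by (auto intro!: Nat.gr0I)
    moreover have "j \<noteq> L - 2"
    proof
      assume "j = L - 2"
      then have "Suc j mod L = L - 1" using L3 by (simp add: Suc_diff_le numeral_2_eq_2)
      then show False using J(2)[OF j(1)] J(3) by simp
    qed
    moreover have "j < L" using J(1) j by auto
    ultimately show ?thesis using j(2) by linarith
  qed
  have "Suc j \<notin> J" if "j \<in> J" "j \<noteq> L - 1" for j
  proof -
    have "Suc j mod L = Suc j" using rng[OF that] by (intro mod_less) linarith
    then show ?thesis using J(2)[OF that(1)] by simp
  qed
  moreover have "J - {L - 1} \<subseteq> {1..<1 + (L - 3)}"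
  proof
    fix x assume "x \<in> J - {L - 1}"
    then show "x \<in> {1..<1 + (L - 3)}" using rng[of x] L3 by auto
  qed
  ultimately have "J - {L - 1} \<in> path_matchings 1 (L - 3)"
    by (simp add: path_matchings_def)
  moreover have "J = insert (L - 1) (J - {L - 1})" using J(3) by auto
  ultimately show "J \<in> insert (L - 1) ` path_matchings 1 (L - 3)" by blast
next
  fix J assume "J \<in> insert (L - 1) ` path_matchings 1 (L - 3)"
  then obtain I where "I \<in> path_matchings 1 (L - 3)" and J: "J = insert (L - 1) I" by blast
  moreover have "1 + (L - 3) = L - 2" using L3 by simp
  ultimately have I: "I \<subseteq> {1..<L - 2}" "\<And>j. j \<in> I \<Longrightarrow> Suc j \<notin> I"
    by (simp_all only: path_matchings_def mem_Collect_eq) simp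
  have "Suc j mod L \<notin> J" if "j \<in> J" for j
  proof (cases "j = L - 1")
    case True
    then show ?thesis using I(1) L3 by (auto simp: J)
  next
    case False
    then have j: "j \<in> I" "j < L - 2" using that I(1) by (auto simp: J)
    then have "Suc j mod L = Suc j" by simp
    then show ?thesis using j I(2)[OF j(1)] by (auto simp: J)
  qed
  moreover have "J \<subseteq> {0..<L}" using L3 subsetD[OF I(1)] by (force simp: J)
  ultimately show "J \<in> {J. J \<in> cyclic_matchings L \<and> L - 1 \<in> J}"
    by (simp add: cyclic_matchings_def J)
qed

lemma card_cyclic_matchings_with_last:
  "card {J. J \<in> cyclic_matchings L \<and> L - 1 \<in> J} = fib (L - 1)"
proof -
  have notin: "L - 1 \<notin> J" if "J \<in> path_matchings 1 (L - 3)" for J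
    using that L3 by (auto simp: path_matchings_def subset_iff dest!: spec[of _ "L - 1"])
  have "card (insert (L - 1) ` path_matchings 1 (L - 3)) = card (path_matchings 1 (L - 3))"
    by (intro card_image inj_onI) (use notin in \<open>metis insert_ident\<close>)
  moreover have "Suc (Suc (L - 3)) = L - 1" using L3 by simp
  ultimately show ?thesis by (simp only: cyclic_matchings_with_last card_path_matchings)
qed

text \<open>Split by whether edge \<open>L - 1\<close> is used; the value is the Lucas number of
  index \<open>L\<close>.\<close>

lemma card_tiles: "card (tiles L) = fib (L + 1) + fib (L - 1)"
proof -
  let ?A = "{J. J \<in> cyclic_matchings L \<and> L - 1 \<notin> J}" and ?B = "{J. J \<in> cyclic_matchings L \<and> L - 1 \<in> J}"
  have "card (tiles L) = card (cyclic_matchings L)"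
    using bij_betw_same_card[OF bij_betw_tile_of[OF L3]] by simp
  also have "cyclic_matchings L = ?A \<union> ?B" by auto
  also have "card \<dots> = card ?A + card ?B"
    by (intro card_Un_disjoint) (auto simp: finite_cyclic_matchings)
  also have "card ?A = fib (L + 1)"
  proof -
    have "Suc (Suc (L - 1)) = L + 1" using L3 by simp
    then show ?thesis by (simp only: cyclic_matchings_without_last card_path_matchings)
  qed
  finally show ?thesis by (simp only: card_cyclic_matchings_with_last)
qed

text \<open>By symmetry each of the two edges at \<open>v\<close> lies in \<open>fib (L - 1)\<close>
  matchings, just as edge \<open>L - 1\<close> does.\<close>

lemma sum_tile_mult_fib:
  assumes "v \<in> {1..L}"
  shows "(\<Sum>t\<in>tiles L. real (tile_mult L t v)) = 2 * real (fib (L - 1))"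
proof -
  have "(\<Sum>J | J \<in> cyclic_matchings L \<and> 0 \<in> J. 1 :: nat) = fib (L - 1)"
    using sum_edge_rotate[OF L3, of "L - 1" "\<lambda>_. 1 :: nat"] L3
      card_cyclic_matchings_with_last by simp
  then show ?thesis
    using sum_tile_mult_const[OF L3 assms, of "\<lambda>_. 1"] by simp
qed

end

lemma lucas_closed_form:
  assumes "0 < n"
  shows "golden_phi ^ n + golden_psi ^ n = real (fib (n + 1) + fib (n - 1))"
proof -
  obtain m where n: "n = Suc m" using assms by (cases n) auto
  let ?a = golden_phi and ?b = golden_psi
  \<comment> \<open>In Binet's formula for the two Fibonacci numbers these factors cancel the
    \<open>sqrt 5\<close> and turn the difference of powers into a sum.\<close>
  have a: "?a\<^sup>2 + 1 = sqrt 5 * ?a" and b: "?b\<^sup>2 + 1 = - sqrt 5 * ?b"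
    by (simp_all add: golden_phi_def golden_psi_def power2_eq_square field_simps)
  have "real (fib (n + 1) + fib (n - 1)) = (?a ^ m * (?a\<^sup>2 + 1) - ?b ^ m * (?b\<^sup>2 + 1)) / sqrt 5"
    using fib_closed_form[of "m + 2"] fib_closed_form[of m]
    unfolding golden_phi_def[symmetric] golden_psi_def[symmetric]
    by (simp add: n power_add power2_eq_square diff_divide_distrib add_divide_distrib algebra_simps)
  also have "\<dots> = ?a ^ n + ?b ^ n"
    unfolding a b by (simp add: n field_simps)
  finally show ?thesis by simp
qed

section \<open>Realising prescribed vertex multiplicities\<close>

text \<open>Shifting the window by one drops \<open>b\<close> and gains \<open>b + L\<close>, which
  has the same residue.\<close>

lemma sum_block_mod:
  fixes f :: "nat \<Rightarrow> nat"
  shows "(\<Sum>k=b..<b + L. f (k mod L)) = (\<Sum>k=0..<L. f k)"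
proof (induction b)
  case (Suc b)
  have "f (b mod L) + (\<Sum>k=Suc b..<Suc b + L. f (k mod L)) = (\<Sum>k=b..<Suc (b + L). f (k mod L))"
    by (simp add: sum.atLeast_Suc_lessThan)
  also have "\<dots> = (\<Sum>k=b..<b + L. f (k mod L)) + f (b mod L)"
    by simp
  finally show ?case using Suc by simp
qed simp

lemma sum_blocks_mod:
  fixes f :: "nat \<Rightarrow> nat"
  shows "(\<Sum>k=b..<b + q * L. f (k mod L)) = q * (\<Sum>k=0..<L. f k)"
proof (induction q)
  case (Suc q)
  have "(\<Sum>k=b..<b + Suc q * L. f (k mod L))
      = (\<Sum>k=b..<b + q * L. f (k mod L)) + (\<Sum>k=b + q * L..<(b + q * L) + L. f (k mod L))"
    by (subst sum.atLeastLessThan_concat) (auto simp: algebra_simps)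
  then show ?case using Suc by (simp add: sum_block_mod)
qed simp

lemma sum_of_bool_odd: "(\<Sum>k=0..<n. of_bool (odd k)) = n div (2 :: nat)"
  by (induction n) (auto elim: oddE)

text \<open>Only the \<open>R div L\<close> complete blocks of length \<open>L\<close> are counted;
  in each of them \<open>(j + k) mod L\<close> runs through all residues, of which
  \<open>L div 2\<close> are odd.\<close>

lemma card_odd_mod_ge:
  "(R div L) * (L div 2) \<le> card {k \<in> {a..<a + R}. odd ((j + k) mod L)}"
proof -
  let ?q = "R div L"
  have "?q * (L div 2) = (\<Sum>k=a + j..<a + j + ?q * L. of_bool (odd (k mod L)))"
    using sum_blocks_mod[of "\<lambda>k. of_bool (odd k)"] by (simp add: sum_of_bool_odd)
  also have "\<dots> = (\<Sum>k=a..<a + ?q * L. of_bool (odd ((j + k) mod L)))"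
    using sum.shift_bounds_nat_ivl[of "\<lambda>k. of_bool (odd (k mod L)) :: nat" a j "a + ?q * L"]
    by (simp add: ac_simps)
  also have "\<dots> \<le> (\<Sum>k=a..<a + R. of_bool (odd ((j + k) mod L)))"
    by (intro sum_mono2) auto
  also have "\<dots> = card {k \<in> {a..<a + R}. odd ((j + k) mod L)}"
    by (simp add: of_bool_def sum.If_cases Int_def)
  finally show ?thesis .
qed

text \<open>The near-perfect matchings of the odd cycle are the index sets
  \<open>{j. odd ((j + k) mod L)}\<close>; over \<open>L\<close> consecutive values of \<open>k\<close> they contain each edge
  \<open>(L - 1) / 2\<close> times. Any smaller edge multiplicities are realised by thinning them out.\<close>

lemma realize_edge_multiplicities:
  assumes L3: "3 \<le> L" and odd: "odd L"
    and c: "\<And>j. j < L \<Longrightarrow> c j \<le> (R div L) * (L div 2)"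
  shows "\<exists>m\<in>{a..<a + R} \<rightarrow>\<^sub>E tiles L. \<forall>v\<in>{1..L}.
    (\<Sum>k=a..<a + R. tile_mult L (m k) v) = c (v - 1) + c (v mod L)"
proof -
  let ?K = "{a..<a + R}"
  \<comment> \<open>\<open>S j\<close> selects the positions at which edge \<open>j\<close> is
    kept.\<close>
  have "\<exists>S. S \<subseteq> {k \<in> ?K. odd ((j + k) mod L)} \<and> card S = c j" if "j < L" for j
  proof -
    have "c j \<le> card {k \<in> ?K. odd ((j + k) mod L)}"
      using c[OF that] card_odd_mod_ge by (rule le_trans)
    then show ?thesis by (rule obtain_subset_with_card_n) blast
  qed
  then have "\<forall>j. \<exists>S. j < L \<longrightarrow> S \<subseteq> {k \<in> ?K. odd ((j + k) mod L)} \<and> card S = c j" by blast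
  from choice[OF this] obtain S where S: "\<And>j. j < L \<Longrightarrow> S j \<subseteq> {k \<in> ?K. odd ((j + k) mod L)}"
    "\<And>j. j < L \<Longrightarrow> card (S j) = c j" by blast
  define J where "J k = {j. j < L \<and> k \<in> S j}" for k
  have J: "J k \<in> cyclic_matchings L" for k
    unfolding cyclic_matchings_def
  proof (intro CollectI conjI ballI notI)
    show "J k \<subseteq> {0..<L}" by (auto simp: J_def)
    fix j assume "j \<in> J k" "Suc j mod L \<in> J k"
    then have "odd ((j + k) mod L)" "odd ((Suc j mod L + k) mod L)"
      using S(1)[of j] S(1)[of "Suc j mod L"] by (auto simp: J_def)
    \<comment> \<open>Passing to the next residue flips the parity or wraps round to
      \<open>0\<close>, which is even, so the two residues are not both odd.\<close>
    moreover have "(Suc j mod L + k) mod L = Suc (j + k) mod L"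
      by (simp add: mod_add_left_eq)
    ultimately show False using odd by (auto simp: mod_Suc split: if_splits)
  qed
  let ?m = "restrict (\<lambda>k. tile_of L (J k)) ?K"
  show ?thesis
  proof (intro bexI ballI)
    show "?m \<in> ?K \<rightarrow>\<^sub>E tiles L" using J by (auto simp: tiles_eq[OF L3])
    fix v assume v: "v \<in> {1..L}"
    have cnt: "(\<Sum>k\<in>?K. of_bool (j \<in> J k)) = c j" if "j < L" for j
    proof -
      have "?K \<inter> {k. j \<in> J k} = S j" using S(1)[OF that] that by (auto simp: J_def)
      then show ?thesis by (simp add: of_bool_def sum.If_cases S(2)[OF that])
    qed
    have "(\<Sum>k\<in>?K. tile_mult L (?m k) v)
        = (\<Sum>k\<in>?K. of_bool (v - 1 \<in> J k) + of_bool (v mod L \<in> J k))"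
      by (intro sum.cong refl) (simp add: tile_mult_tile_of[OF L3 J v])
    also have "\<dots> = c (v - 1) + c (v mod L)"
    proof -
      have "v - 1 < L" "v mod L < L" using v by auto
      then show ?thesis by (simp only: sum.distrib cnt)
    qed
    finally show "(\<Sum>k=a..<a + R. tile_mult L (?m k) v) = c (v - 1) + c (v mod L)" .
  qed
qed

lemma alternating_sum_odd:
  assumes "odd n"
  shows "(\<Sum>i=1..n. (- 1) ^ (i + 1)) = (1 :: real)"
proof -
  have "(\<Sum>i=1..n. (- 1 :: real) ^ (i + 1)) = of_bool (odd n)" by (induction n) auto
  then show ?thesis using assms by simp
qed

text \<open>The vertex-edge incidence system \<open>c\<^sub>v\<^sub>-\<^sub>1 + c\<^sub>v = r\<^sub>v\<close> of an odd cycle is solved over the integers by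
  \<open>2 c\<^sub>0 = r\<^sub>1 - r\<^sub>2 + \<dots> + r\<^sub>L\<close>, and the solution depends continuously on \<open>r\<close>.\<close>

lemma odd_cycle_solve:
  fixes r :: "nat \<Rightarrow> int" and \<beta> e :: real
  assumes odd: "odd L" and ev: "even (\<Sum>i=1..L. r i)"
    and r: "\<And>i. i \<in> {1..L} \<Longrightarrow> \<bar>real_of_int (r i) - 2 * \<beta>\<bar> \<le> e"
  shows "\<exists>c. (\<forall>v\<in>{1..L}. c (v - 1) + c (v mod L) = r v)
    \<and> (\<forall>j<L. \<bar>real_of_int (c j) - \<beta>\<bar> \<le> 2 * real L * e)"
proof -
  let ?s = "\<lambda>n. \<Sum>i=1..n. (- 1) ^ (i + 1) * r i"
  \<comment> \<open>Changing signs preserves parity, so the alternating sum is even along with the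
    plain one.\<close>
  have "even (r i - (- 1) ^ (i + 1) * r i)" for i
    by (cases "even i") auto
  then have "even (\<Sum>i=1..L. r i - (- 1) ^ (i + 1) * r i)"
    by (intro dvd_sum) auto
  then have "even (?s L)" using ev by (simp only: sum_subtractf even_diff even_add)
  then obtain c0 where c0: "?s L = 2 * c0" by (elim evenE)
  define c where "c = rec_nat c0 (\<lambda>j x. r (Suc j) - x)"
  have c_0: "c 0 = c0" and c_Suc: "c (Suc j) = r (Suc j) - c j" for j
    by (simp_all add: c_def)
  have "(- 1) ^ j * c j = c0 - ?s j" for j
    by (induction j) (simp_all add: c_0 c_Suc algebra_simps)
  \<comment> \<open>For odd \<open>L\<close> this instance reads \<open>- c L = c0 - 2 * c0\<close>:
    the recursion closes up around the cycle.\<close>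
  from this[of L] have c_L: "c L = c0" using odd c0 by simp
  have sol: "c (v - 1) + c (v mod L) = r v" if v: "v \<in> {1..L}" for v
  proof -
    have "c (v mod L) = c v" using v c_L c_0 by (cases "v = L") auto
    then show ?thesis using v c_Suc[of "v - 1"] by simp
  qed
  have L0: "0 < L" using odd by (auto intro!: Nat.gr0I)
  have e0: "0 \<le> e" using r[of 1] L0 by auto
  \<comment> \<open>The signs add up to \<open>1\<close>, so the constant \<open>2 * \<beta>\<close>
    can be moved into the alternating sum and only the deviations of \<open>r\<close>
    remain.\<close>
  have "real_of_int (?s L) - 2 * \<beta> = real_of_int (?s L) - 2 * \<beta> * (\<Sum>i=1..L. (- 1) ^ (i + 1))"
    using alternating_sum_odd[OF odd] by simp
  also have "\<dots> = (\<Sum>i=1..L. (- 1) ^ (i + 1) * (real_of_int (r i) - 2 * \<beta>))"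
    unfolding right_diff_distrib sum_subtractf sum_distrib_left of_int_sum
    by (simp add: mult.commute)
  finally have "\<bar>real_of_int (?s L) - 2 * \<beta>\<bar> \<le> (\<Sum>i=1..L. \<bar>(- 1) ^ (i + 1) * (real_of_int (r i) - 2 * \<beta>)\<bar>)"
    by (simp only: sum_abs)
  also have "\<dots> \<le> (\<Sum>i=1..L. e)"
    by (intro sum_mono) (simp add: abs_mult r)
  also have "\<dots> = real L * e" by simp
  finally have "\<bar>2 * real_of_int c0 - 2 * \<beta>\<bar> \<le> real L * e" by (simp only: c0)
  then have start: "\<bar>real_of_int c0 - \<beta>\<bar> \<le> real L * e"
    using mult_nonneg_nonneg[OF of_nat_0_le_iff[of L] e0] by linarith
  \<comment> \<open>Each step of the recursion adds at most one \<open>e\<close> to the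
    error.\<close>
  have bound: "\<bar>real_of_int (c j) - \<beta>\<bar> \<le> real L * e + real j * e" if "j \<le> L" for j
    using that
  proof (induction j)
    case 0
    then show ?case using start by (simp add: c_0)
  next
    case (Suc j)
    have "\<bar>real_of_int (r (Suc j)) - 2 * \<beta>\<bar> \<le> e" using Suc.prems by (intro r) auto
    moreover have "\<bar>real_of_int (c j) - \<beta>\<bar> \<le> real L * e + real j * e" using Suc by simp
    moreover have "real (Suc j) * e = e + real j * e" by (simp add: algebra_simps)
    ultimately show ?case by (simp only: c_Suc of_int_diff)
  qed
  have "\<bar>real_of_int (c j) - \<beta>\<bar> \<le> 2 * real L * e" if "j < L" for j
  proof -
    have "real j * e \<le> real L * e" using that e0 by (intro mult_right_mono) auto
    moreover have "2 * real L * e = real L * e + real L * e" by simp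
    ultimately show ?thesis using bound[of j] that by linarith
  qed
  with sol show ?thesis by (intro exI[of _ c]) blast
qed

text \<open>The edge solution lies within \<open>2 * real L * e\<close> of \<open>\<beta>\<close>;
  \<open>lo\<close> keeps it nonnegative, and \<open>hi\<close> keeps it below the number of times
  that near-perfect matchings are sure to supply each edge.\<close>

lemma realize_vertex_multiplicities:
  fixes r :: "nat \<Rightarrow> int" and \<beta> e :: real
  assumes L3: "3 \<le> L" and odd: "odd L" and ev: "even (\<Sum>i=1..L. r i)"
    and r: "\<And>i. i \<in> {1..L} \<Longrightarrow> \<bar>real_of_int (r i) - 2 * \<beta>\<bar> \<le> e"
    and lo: "2 * real L * e \<le> \<beta>" and hi: "\<beta> + 2 * real L * e \<le> real ((R div L) * (L div 2))"
  shows "\<exists>m\<in>{a..<a + R} \<rightarrow>\<^sub>E tiles L. \<forall>v\<in>{1..L}.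
    int (\<Sum>k=a..<a + R. tile_mult L (m k) v) = r v"
proof -
  have "\<exists>c. (\<forall>v\<in>{1..L}. c (v - 1) + c (v mod L) = r v)
      \<and> (\<forall>j<L. \<bar>real_of_int (c j) - \<beta>\<bar> \<le> 2 * real L * e)"
    by (rule odd_cycle_solve[OF odd ev]) (rule r)
  then obtain c where c: "\<And>v. v \<in> {1..L} \<Longrightarrow> c (v - 1) + c (v mod L) = r v"
    "\<And>j. j < L \<Longrightarrow> \<bar>real_of_int (c j) - \<beta>\<bar> \<le> 2 * real L * e"
    by blast
  have nonneg: "0 \<le> c j" if "j < L" for j
    using c(2)[OF that] lo by linarith
  have "nat (c j) \<le> (R div L) * (L div 2)" if "j < L" for j
  proof -
    have "real_of_int (c j) \<le> real_of_int (int ((R div L) * (L div 2)))"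
      using c(2)[OF that] hi by simp
    then show ?thesis by (simp only: of_int_le_iff nat_le_iff)
  qed
  then have "\<exists>m\<in>{a..<a + R} \<rightarrow>\<^sub>E tiles L. \<forall>v\<in>{1..L}.
      (\<Sum>k=a..<a + R. tile_mult L (m k) v) = nat (c (v - 1)) + nat (c (v mod L))"
    by (rule realize_edge_multiplicities[OF L3 odd])
  then obtain m where m: "m \<in> {a..<a + R} \<rightarrow>\<^sub>E tiles L"
    "\<forall>v\<in>{1..L}. (\<Sum>k=a..<a + R. tile_mult L (m k) v) = nat (c (v - 1)) + nat (c (v mod L))"
    by blast
  have "int (\<Sum>k=a..<a + R. tile_mult L (m k) v) = r v" if v: "v \<in> {1..L}" for v
  proof -
    have "v - 1 < L" "v mod L < L" using v by auto
    then have "0 \<le> c (v - 1)" "0 \<le> c (v mod L)" by (auto intro: nonneg)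
    then show ?thesis by (simp only: m(2)[rule_format, OF v] of_nat_add int_nat_eq if_True c(1)[OF v])
  qed
  with m(1) show ?thesis by blast
qed

section \<open>The growth rate\<close>

text \<open>The tiling polynomial at \<open>x_0 = 1\<close> and \<open>x_i = sqrt y\<close> for the
  cycle vertices.\<close>

definition matching_poly :: "nat \<Rightarrow> real \<Rightarrow> real" where
  "matching_poly L y = (\<Sum>t\<in>tiles L. y ^ card t)"

text \<open>The expression \<open>log P - sum of \<alpha>_i log x_i\<close> at the same point; it is
  the entropy of the weights proportional to \<open>y ^ card t\<close> if these have density
  \<open>\<alpha>\<close>.\<close>

definition entropy_rate :: "nat \<Rightarrow> real \<Rightarrow> real \<Rightarrow> real" where
  "entropy_rate L \<alpha> y = ln (matching_poly L y) - real L * \<alpha> / 2 * ln y"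

text \<open>Here \<open>y\<close> is the activity of a monomer-dimer model on the cycle, and
  \<open>activity\<close> is the critical equation \<open>x_i P_i / P = \<alpha>\<close> at
  \<open>x_i = sqrt y\<close>, where \<open>P_i\<close> is the partial derivative.\<close>

locale tile_activity =
  fixes L :: nat and \<alpha> y :: real
  assumes L3: "3 \<le> L" and odd_L: "odd L"
    and y_pos: "0 < y" and \<alpha>_pos: "0 < \<alpha>" and \<alpha>_less: "\<alpha> < (real L - 1) / real L"
    and activity: "\<And>v. v \<in> {1..L} \<Longrightarrow>
      (\<Sum>t\<in>tiles L. real (tile_mult L t v) * y ^ card t) = \<alpha> * matching_poly L y"
begin

section \<open>Upper bound on the number of multiwebs\<close>

lemma finite_multiwebs: "finite (multiwebs L N n)"
proof (rule finite_subset)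
  show "multiwebs L N n \<subseteq> {1..N} \<rightarrow>\<^sub>E tiles L" unfolding multiwebs_def by blast
  show "finite ({1..N} \<rightarrow>\<^sub>E tiles L)" by (intro finite_PiE finite_tiles[OF L3]) simp
qed

lemma matching_poly_pos: "0 < matching_poly L y"
  unfolding matching_poly_def
proof (rule sum_pos[OF finite_tiles[OF L3]])
  show "tiles L \<noteq> {}" using empty_in_tiles[OF L3] by blast
  show "0 < y ^ card t" for t :: "nat set set" using y_pos by simp
qed

lemma sum_vertex_counts:
  assumes "\<And>k. k \<in> A \<Longrightarrow> m k \<in> tiles L"
  shows "(\<Sum>i=1..L. \<Sum>k\<in>A. tile_mult L (m k) i) = 2 * (\<Sum>k\<in>A. card (m k))"
proof -
  have "(\<Sum>i=1..L. \<Sum>k\<in>A. tile_mult L (m k) i) = (\<Sum>k\<in>A. \<Sum>i=1..L. tile_mult L (m k) i)"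
    by (rule sum.swap)
  also have "\<dots> = (\<Sum>k\<in>A. 2 * card (m k))"
    using assms by (intro sum.cong refl sum_tile_mult[OF L3]) auto
  finally show ?thesis by (simp add: sum_distrib_left)
qed

text \<open>All multiwebs with the same \<open>n\<close> therefore use the same number of edges and
  have the same weight; moreover the sum of \<open>n\<close> is even.\<close>

lemma multiweb_sum_eq:
  assumes "m \<in> multiwebs L N n"
  shows "(\<Sum>i=1..L. n i) = 2 * (\<Sum>k=1..N. card (m k))"
proof -
  have "(\<Sum>i=1..L. n i) = (\<Sum>i=1..L. \<Sum>k=1..N. tile_mult L (m k) i)"
    using assms by (intro sum.cong) (auto simp: multiwebs_def)
  also have "\<dots> = 2 * (\<Sum>k=1..N. card (m k))"
    using assms by (intro sum_vertex_counts) (auto simp: multiwebs_def)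
  finally show ?thesis .
qed

lemma prod_activity: "(\<Prod>k\<in>A. y ^ card (m k)) = exp (real (\<Sum>k\<in>A. card (m k)) * ln y)"
proof -
  have "(\<Prod>k\<in>A. y ^ card (m k)) = y ^ (\<Sum>k\<in>A. card (m k))"
    by (simp only: power_sum)
  also have "\<dots> = exp (real (\<Sum>k\<in>A. card (m k)) * ln y)"
    using y_pos by (simp only: exp_of_nat_mult exp_ln)
  finally show ?thesis .
qed

text \<open>Every multiweb for \<open>n\<close> has weight \<open>y\<close> to half the sum of
  \<open>n\<close>, and together they weigh no more than all sequences of \<open>N\<close>
  tiles.\<close>

lemma ln_partition_function_le:
  assumes Z: "0 < partition_function L N n"
  shows "ln (real (partition_function L N n))
    \<le> real N * ln (matching_poly L y) - (\<Sum>i=1..L. real (n i)) / 2 * ln y"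
proof -
  let ?S = "(\<Sum>i=1..L. real (n i)) / 2"
  have S: "real (\<Sum>k=1..N. card (m k)) = ?S" if "m \<in> multiwebs L N n" for m
  proof -
    have "real (\<Sum>i=1..L. n i) = real (2 * (\<Sum>k=1..N. card (m k)))"
      by (simp only: multiweb_sum_eq[OF that])
    then show ?thesis by simp
  qed
  have "real (partition_function L N n) * exp (?S * ln y)
      = (\<Sum>m\<in>multiwebs L N n. \<Prod>k=1..N. y ^ card (m k))"
  proof -
    have "(\<Sum>m\<in>multiwebs L N n. \<Prod>k=1..N. y ^ card (m k)) = (\<Sum>m\<in>multiwebs L N n. exp (?S * ln y))"
      by (intro sum.cong refl) (simp only: prod_activity S)
    then show ?thesis by (simp add: partition_function_def)
  qed
  also have "\<dots> \<le> (\<Sum>m\<in>{1..N} \<rightarrow>\<^sub>E tiles L. \<Prod>k=1..N. y ^ card (m k))"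
    using y_pos finite_tiles[OF L3]
    by (intro sum_mono2 finite_PiE prod_nonneg) (auto simp: multiwebs_def)
  also have "\<dots> = matching_poly L y ^ N"
    using sum_PiE_prod_const[of "{1..N}" "tiles L" "\<lambda>t. y ^ card t"] finite_tiles[OF L3]
    by (simp add: matching_poly_def)
  finally have "ln (real (partition_function L N n) * exp (?S * ln y)) \<le> ln (matching_poly L y ^ N)"
    using Z by (intro ln_mono) auto
  then show ?thesis
    using Z matching_poly_pos by (simp add: ln_mult ln_realpow)
qed

section \<open>Lower bound from typical sequences\<close>

definition typical :: "nat \<Rightarrow> real \<Rightarrow> (nat \<Rightarrow> nat set set) set" where
  "typical M \<delta> = {m \<in> {1..M} \<rightarrow>\<^sub>E tiles L.
    \<forall>i\<in>{1..L}. \<bar>(\<Sum>k=1..M. real (tile_mult L (m k) i)) - real M * \<alpha>\<bar> \<le> \<delta> * real M}"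

lemma \<alpha>_less_1: "\<alpha> < 1"
proof -
  have "(real L - 1) / real L < 1" using L3 by simp
  then show ?thesis using \<alpha>_less by linarith
qed

text \<open>By the Chernoff estimate typical sequences carry at least half of the probability. Each
  has probability at most \<open>?b\<close>, since its number of edges differs from
  \<open>real L * \<alpha> / 2 * real M\<close> by at most
  \<open>real L * \<delta> / 2 * real M\<close>. The quotient bounds their number.\<close>

lemma card_typical_ge:
  assumes \<delta>: "0 \<le> \<delta>" "\<delta> \<le> 2" and small: "2 * real L * exp (- \<delta>\<^sup>2 / 4 * real M) \<le> 1 / 2"
  shows "exp (real M * (entropy_rate L \<alpha> y - real L * \<delta> * \<bar>ln y\<bar> / 2)) / 2 \<le> real (card (typical M \<delta>))"
proof -
  let ?Q = "matching_poly L y" and ?T = "tiles L"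
  let ?w = "\<lambda>t :: nat set set. y ^ card t / ?Q"
  let ?X = "\<lambda>i t. real (tile_mult L t i) - \<alpha>"
  let ?b = "exp (- real M * (entropy_rate L \<alpha> y - real L * \<delta> * \<bar>ln y\<bar> / 2))"
  note Q = matching_poly_pos and fT = finite_tiles[OF L3]
  have sum_w: "(\<Sum>t\<in>?T. ?w t) = 1"
    using Q by (simp add: sum_divide_distrib[symmetric] matching_poly_def)
  have "1 - 2 * real (card {1..L}) * exp (- \<delta>\<^sup>2 / 4 * real (card {1..M}))
    \<le> (\<Sum>m | m \<in> {1..M} \<rightarrow>\<^sub>E ?T \<and> (\<forall>i\<in>{1..L}. \<bar>\<Sum>k\<in>{1..M}. ?X i (m k)\<bar> \<le> \<delta> * real (card {1..M})).
        \<Prod>k\<in>{1..M}. ?w (m k))"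
  proof (rule typical_weight_ge[OF fT])
    show "0 \<le> ?w t" for t using Q y_pos by simp
    show "\<bar>?X i t\<bar> \<le> 1" if "i \<in> {1..L}" for i t
      using that \<alpha>_pos \<alpha>_less_1 by (auto simp: tile_mult_def)
    show "(\<Sum>t\<in>?T. ?w t * ?X i t) = 0" if "i \<in> {1..L}" for i
    proof -
      have "(\<Sum>t\<in>?T. ?w t * ?X i t)
          = (\<Sum>t\<in>?T. real (tile_mult L t i) * y ^ card t) / ?Q - \<alpha> * (\<Sum>t\<in>?T. ?w t)"
        by (simp add: sum_divide_distrib sum_distrib_left sum_subtractf[symmetric] algebra_simps diff_divide_distrib)
      also have "\<dots> = 0" using activity[OF that] Q sum_w by simp
      finally show ?thesis .
    qed
  qed (use sum_w \<delta> in auto)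
  also have "{m. m \<in> {1..M} \<rightarrow>\<^sub>E ?T \<and> (\<forall>i\<in>{1..L}. \<bar>\<Sum>k\<in>{1..M}. ?X i (m k)\<bar> \<le> \<delta> * real (card {1..M}))} = typical M \<delta>"
    by (simp add: typical_def sum_subtractf)
  also have "(\<Sum>m\<in>typical M \<delta>. \<Prod>k\<in>{1..M}. ?w (m k)) \<le> (\<Sum>m\<in>typical M \<delta>. ?b)"
  proof (rule sum_mono)
    fix m assume m: "m \<in> typical M \<delta>"
    let ?S = "real (\<Sum>k=1..M. card (m k))"
    have "(\<Sum>i=1..L. \<Sum>k=1..M. tile_mult L (m k) i) = 2 * (\<Sum>k=1..M. card (m k))"
      using m by (intro sum_vertex_counts) (auto simp: typical_def)
    then have "real (\<Sum>i=1..L. \<Sum>k=1..M. tile_mult L (m k) i) = real (2 * (\<Sum>k=1..M. card (m k)))"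
      by (simp only:)
    then have "2 * ?S - real L * (real M * \<alpha>) = (\<Sum>i=1..L. (\<Sum>k=1..M. real (tile_mult L (m k) i)) - real M * \<alpha>)"
      by (simp add: sum_subtractf)
    then have "\<bar>2 * ?S - real L * (real M * \<alpha>)\<bar>
        \<le> (\<Sum>i=1..L. \<bar>(\<Sum>k=1..M. real (tile_mult L (m k) i)) - real M * \<alpha>\<bar>)"
      by (simp only: sum_abs)
    also have "\<dots> \<le> (\<Sum>i=1..L. \<delta> * real M)"
      using m by (intro sum_mono) (auto simp: typical_def)
    also have "\<dots> = real L * \<delta> * real M" by simp
    finally have dev: "\<bar>?S - real L * \<alpha> / 2 * real M\<bar> \<le> real L * \<delta> / 2 * real M"
      by (simp add: abs_le_iff field_simps)
    have "(?S - real L * \<alpha> / 2 * real M) * ln y \<le> real L * \<delta> / 2 * real M * \<bar>ln y\<bar>"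
      using mult_right_mono[OF dev abs_ge_zero[of "ln y"]] by (simp only: abs_mult[symmetric])
    then have "?S * ln y - real M * ln ?Q
        \<le> - real M * (entropy_rate L \<alpha> y - real L * \<delta> * \<bar>ln y\<bar> / 2)"
      by (simp add: entropy_rate_def algebra_simps)
    moreover have "(\<Prod>k\<in>{1..M}. ?w (m k)) = exp (?S * ln y - real M * ln ?Q)"
      using Q by (simp add: prod_dividef prod_activity exp_diff exp_of_nat_mult del: of_nat_sum)
    ultimately show "(\<Prod>k\<in>{1..M}. ?w (m k)) \<le> ?b" by simp
  qed
  also have "\<dots> = real (card (typical M \<delta>)) * ?b" by simp
  finally have "1 / 2 \<le> real (card (typical M \<delta>)) * ?b" using small by simp
  then have "1 / 2 / ?b \<le> real (card (typical M \<delta>))" by (subst divide_le_eq) auto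
  moreover have "1 / 2 / exp (- z) = exp z / 2" for z :: real
    by (simp add: exp_minus inverse_eq_divide)
  ultimately show ?thesis by (simp only: mult_minus_left)
qed

text \<open>Each typical sequence is completed on the last \<open>R\<close> positions by tiles
  supplying the missing counts. Completion is injective because the first \<open>M\<close> positions
  are unchanged.\<close>

lemma card_typical_le_partition_function:
  assumes Z: "0 < partition_function L (M + R) n" and \<delta>: "0 \<le> \<delta>"
    and n: "\<And>i. i \<in> {1..L} \<Longrightarrow> \<bar>real (n i) - real (M + R) * \<alpha>\<bar> \<le> \<delta> * real (M + R)"
    and lo: "4 * real L * \<delta> * real (M + R) \<le> real R * \<alpha> / 2"
    and hi: "real R * \<alpha> / 2 + 4 * real L * \<delta> * real (M + R) \<le> real ((R div L) * (L div 2))"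
  shows "card (typical M \<delta>) \<le> partition_function L (M + R) n"
proof -
  let ?K = "{M + 1..<M + 1 + R}"
  have ex: "\<exists>g\<in>?K \<rightarrow>\<^sub>E tiles L. \<forall>i\<in>{1..L}.
      int (\<Sum>k\<in>?K. tile_mult L (g k) i) = int (n i) - int (\<Sum>k=1..M. tile_mult L (m k) i)"
    if m: "m \<in> typical M \<delta>" for m
  proof (rule realize_vertex_multiplicities[OF L3 odd_L])
    \<comment> \<open>Parity: an existing multiweb shows that \<open>n\<close> has an even sum, and
      the counts of \<open>m\<close> have one by double counting.\<close>
    obtain m' where "m' \<in> multiwebs L (M + R) n"
      using Z by (auto simp: partition_function_def card_gt_0_iff)
    from multiweb_sum_eq[OF this] have "even (\<Sum>i=1..L. n i)" by (simp only: dvd_triv_left)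
    moreover have "even (\<Sum>i=1..L. \<Sum>k=1..M. tile_mult L (m k) i)"
      using m by (subst sum_vertex_counts) (auto simp: typical_def)
    ultimately have "even (int (\<Sum>i=1..L. n i) - int (\<Sum>i=1..L. \<Sum>k=1..M. tile_mult L (m k) i))"
      by (simp only: even_diff even_add even_of_nat)
    then show "even (\<Sum>i=1..L. int (n i) - int (\<Sum>k=1..M. tile_mult L (m k) i))"
      by (simp only: sum_subtractf of_nat_sum)
    \<comment> \<open>The target and the typical sequence each deviate by at most
      \<open>\<delta> * real (M + R)\<close>, which gives the factor \<open>2\<close>.\<close>
    show "\<bar>real_of_int (int (n i) - int (\<Sum>k=1..M. tile_mult L (m k) i)) - 2 * (real R * \<alpha> / 2)\<bar>
        \<le> 2 * \<delta> * real (M + R)" if i: "i \<in> {1..L}" for i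
    proof -
      have "\<bar>(\<Sum>k=1..M. real (tile_mult L (m k) i)) - real M * \<alpha>\<bar> \<le> \<delta> * real M"
        using m i by (auto simp: typical_def)
      also have "\<dots> \<le> \<delta> * real (M + R)" using \<delta> by (intro mult_left_mono) auto
      finally have "\<bar>(\<Sum>k=1..M. real (tile_mult L (m k) i)) - real M * \<alpha>\<bar> \<le> \<delta> * real (M + R)" .
      moreover have "real (M + R) * \<alpha> = real M * \<alpha> + real R * \<alpha>" by (simp add: algebra_simps)
      moreover have "real_of_int (int (n i) - int (\<Sum>k=1..M. tile_mult L (m k) i))
          = real (n i) - (\<Sum>k=1..M. real (tile_mult L (m k) i))" by simp
      ultimately show ?thesis using n[OF i] by linarith
    qed
    show "2 * real L * (2 * \<delta> * real (M + R)) \<le> real R * \<alpha> / 2" using lo by (simp add: mult_ac)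
    show "real R * \<alpha> / 2 + 2 * real L * (2 * \<delta> * real (M + R)) \<le> real ((R div L) * (L div 2))"
      using hi by (simp add: mult_ac)
  qed
  have "\<forall>m\<in>typical M \<delta>. \<exists>g. g \<in> ?K \<rightarrow>\<^sub>E tiles L \<and> (\<forall>i\<in>{1..L}.
      int (\<Sum>k\<in>?K. tile_mult L (g k) i) = int (n i) - int (\<Sum>k=1..M. tile_mult L (m k) i))"
    using ex by blast
  from bchoice[OF this] obtain g where g: "\<And>m. m \<in> typical M \<delta> \<Longrightarrow> g m \<in> ?K \<rightarrow>\<^sub>E tiles L"
    "\<And>m i. m \<in> typical M \<delta> \<Longrightarrow> i \<in> {1..L} \<Longrightarrow>
      int (\<Sum>k\<in>?K. tile_mult L (g m k) i) = int (n i) - int (\<Sum>k=1..M. tile_mult L (m k) i)"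
    by blast
  define ext where "ext m = (\<lambda>k. if k \<le> M then m k else g m k)" for m
  have "ext ` typical M \<delta> \<subseteq> multiwebs L (M + R) n"
  proof
    fix x assume "x \<in> ext ` typical M \<delta>"
    then obtain m where m: "m \<in> typical M \<delta>" and x: "x = ext m" by auto
    have mT: "m \<in> {1..M} \<rightarrow>\<^sub>E tiles L" using m by (simp add: typical_def)
    have un: "{1..M + R} = {1..M} \<union> ?K" by auto
    have "ext m \<in> {1..M + R} \<rightarrow>\<^sub>E tiles L"
    proof (rule PiE_I)
      fix k assume "k \<in> {1..M + R}"
      then show "ext m k \<in> tiles L"
        using PiE_mem[OF mT, of k] PiE_mem[OF g(1)[OF m], of k] by (auto simp: ext_def)
    next
      fix k assume "k \<notin> {1..M + R}"
      then show "ext m k = undefined"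
        using PiE_arb[OF mT, of k] PiE_arb[OF g(1)[OF m], of k] by (auto simp: ext_def)
    qed
    moreover have "(\<Sum>k=1..M + R. tile_mult L (ext m k) i) = n i" if i: "i \<in> {1..L}" for i
    proof -
      have "(\<Sum>k=1..M + R. tile_mult L (ext m k) i)
          = (\<Sum>k=1..M. tile_mult L (ext m k) i) + (\<Sum>k\<in>?K. tile_mult L (ext m k) i)"
        unfolding un by (intro sum.union_disjoint) auto
      also have "(\<Sum>k=1..M. tile_mult L (ext m k) i) = (\<Sum>k=1..M. tile_mult L (m k) i)"
        by (intro sum.cong) (auto simp: ext_def)
      also have "(\<Sum>k\<in>?K. tile_mult L (ext m k) i) = (\<Sum>k\<in>?K. tile_mult L (g m k) i)"
        by (intro sum.cong) (auto simp: ext_def)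
      finally show ?thesis using g(2)[OF m i] by linarith
    qed
    ultimately show "x \<in> multiwebs L (M + R) n" by (simp add: multiwebs_def x)
  qed
  moreover have "inj_on ext (typical M \<delta>)"
  proof (rule inj_onI)
    fix m m' assume m: "m \<in> typical M \<delta>" "m' \<in> typical M \<delta>" and eq: "ext m = ext m'"
    have "m k = m' k" if "k \<in> {1..M}" for k
      using fun_cong[OF eq, of k] that by (simp add: ext_def)
    then show "m = m'"
      using m by (intro PiE_ext[of m "{1..M}" "\<lambda>_. tiles L" m']) (auto simp: typical_def)
  qed
  ultimately show ?thesis
    unfolding partition_function_def by (intro card_inj_on_le[of ext] finite_multiwebs)
qed

text \<open>A fraction \<open>\<epsilon>\<close> of the positions is reserved for the completion.
  Giving them up and allowing the tolerance \<open>\<delta>\<close> costs the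
  \<open>\<epsilon>\<close> term; \<open>ln 2\<close> comes from the half in the count of typical
  sequences.\<close>

lemma ln_partition_function_ge:
  assumes \<epsilon>: "0 < \<epsilon>" "\<epsilon> < 1"
  shows "\<exists>\<delta>>0. \<forall>\<^sub>F N in sequentially. \<forall>n. 0 < partition_function L N n \<longrightarrow>
      (\<forall>i\<in>{1..L}. \<bar>real (n i) - real N * \<alpha>\<bar> \<le> \<delta> * real N) \<longrightarrow>
      real N * (entropy_rate L \<alpha> y - \<epsilon> * (\<bar>entropy_rate L \<alpha> y\<bar> + \<bar>ln y\<bar>)) - ln 2
        \<le> ln (real (partition_function L N n))"
proof -
  let ?H = "entropy_rate L \<alpha> y"
  \<comment> \<open>The distance of \<open>\<alpha>\<close> from the ends of the feasible interval:
    the first entry leaves room above \<open>0\<close> for the edge multiplicities, the second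
    leaves room below the capacity of the near-perfect matchings.\<close>
  define \<mu> where "\<mu> = min \<alpha> ((real L - 1) / real L - \<alpha>)"
  have \<mu>: "0 < \<mu>" "\<mu> \<le> \<alpha>" "\<mu> \<le> (real L - 1) / real L - \<alpha>" "\<mu> < 1"
    using \<alpha>_pos \<alpha>_less \<alpha>_less_1 by (auto simp: \<mu>_def)
  \<comment> \<open>Makes the error \<open>4 * real L * \<delta> * real N\<close> of the completion
    a quarter of \<open>\<mu> * (\<epsilon> * real N)\<close>.\<close>
  define \<delta> where "\<delta> = \<mu> * \<epsilon> / (16 * real L)"
  have L0: "0 < real L" using L3 by simp
  have \<delta>0: "0 < \<delta>" using \<mu> \<epsilon> L0 by (simp add: \<delta>_def)
  have \<mu>\<epsilon>: "\<mu> * \<epsilon> \<le> \<epsilon>" using \<mu> \<epsilon> by (simp add: mult_left_le_one_le)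
  have L\<delta>: "16 * (real L * \<delta>) = \<mu> * \<epsilon>" using L0 by (simp add: \<delta>_def)
  have "1 * \<delta> \<le> real L * \<delta>" using L3 \<delta>0 by (intro mult_right_mono) auto
  then have \<delta>2: "\<delta> \<le> 2" using L\<delta> \<mu>\<epsilon> \<epsilon> by linarith
  have "0 < \<delta>\<^sup>2 / 4 * (1 - \<epsilon>)" using \<delta>0 \<epsilon> by simp
  from filterlim_tendsto_pos_mult_at_top[OF tendsto_const this filterlim_real_sequentially]
  have lim: "filterlim (\<lambda>N. \<delta>\<^sup>2 / 4 * ((1 - \<epsilon>) * real N)) at_top sequentially"
    by (simp only: mult.assoc)
  have "((\<lambda>N. exp (- (\<delta>\<^sup>2 / 4 * ((1 - \<epsilon>) * real N)))) \<longlonglongrightarrow> 0)"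
    by (rule filterlim_compose[OF exp_at_bot filterlim_compose[OF filterlim_uminus_at_bot_at_top lim]])
  from tendsto_mult[OF tendsto_const this, of "2 * real L"]
  have "((\<lambda>N. 2 * real L * exp (- (\<delta>\<^sup>2 / 4 * ((1 - \<epsilon>) * real N)))) \<longlonglongrightarrow> 0)"
    by simp
  then have ev1: "\<forall>\<^sub>F N in sequentially. 2 * real L * exp (- (\<delta>\<^sup>2 / 4 * ((1 - \<epsilon>) * real N))) < 1 / 2"
    by (rule order_tendstoD) simp
  \<comment> \<open>For such \<open>N\<close> the slack absorbs the rounding in \<open>R\<close> and
    in \<open>R div L\<close>.\<close>
  have ev2: "\<forall>\<^sub>F N in sequentially. 4 * real L / (\<mu> * \<epsilon>) \<le> real N"
    using filterlim_real_sequentially by (simp add: filterlim_at_top)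
  show ?thesis
  proof (intro exI[of _ \<delta>] conjI \<delta>0)
    show "\<forall>\<^sub>F N in sequentially. \<forall>n. 0 < partition_function L N n \<longrightarrow>
      (\<forall>i\<in>{1..L}. \<bar>real (n i) - real N * \<alpha>\<bar> \<le> \<delta> * real N) \<longrightarrow>
      real N * (?H - \<epsilon> * (\<bar>?H\<bar> + \<bar>ln y\<bar>)) - ln 2 \<le> ln (real (partition_function L N n))"
      using ev1 ev2
    proof eventually_elim
      case (elim N)
      show ?case
      proof (intro allI impI)
        fix n assume Z: "0 < partition_function L N n"
          and n: "\<forall>i\<in>{1..L}. \<bar>real (n i) - real N * \<alpha>\<bar> \<le> \<delta> * real N"
        define R where "R = nat \<lfloor>\<epsilon> * real N\<rfloor>"
        have R: "real R \<le> \<epsilon> * real N" "\<epsilon> * real N - 1 \<le> real R"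
          using \<epsilon> by (auto simp: R_def intro: of_nat_floor)
        have "\<epsilon> * real N \<le> real N" using \<epsilon> by (simp add: mult_left_le_one_le)
        then have "real R \<le> real N" using R by linarith
        then have "R \<le> N" by simp
        then obtain M where N: "N = M + R" by (metis le_iff_add add.commute)
        have M: "(1 - \<epsilon>) * real N \<le> real M" using R by (simp add: N algebra_simps)
        have "\<delta>\<^sup>2 / 4 * ((1 - \<epsilon>) * real N) \<le> \<delta>\<^sup>2 / 4 * real M"
          by (intro mult_left_mono M) simp
        then have "2 * real L * exp (- \<delta>\<^sup>2 / 4 * real M) \<le> 2 * real L * exp (- (\<delta>\<^sup>2 / 4 * ((1 - \<epsilon>) * real N)))"
          by (intro mult_left_mono) auto
        then have small: "2 * real L * exp (- \<delta>\<^sup>2 / 4 * real M) \<le> 1 / 2" using elim(1) by linarith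
        have big: "4 * real L \<le> \<mu> * (\<epsilon> * real N)"
          using elim(2) \<mu>(1) \<epsilon>(1) by (simp add: field_simps)
        have L\<delta>N: "4 * real L * \<delta> * real N = \<mu> * (\<epsilon> * real N) / 4"
        proof -
          have "4 * real L * \<delta> * real N = 16 * (real L * \<delta>) * real N / 4" by simp
          then show ?thesis by (simp only: L\<delta> mult.assoc)
        qed
        have "\<mu> * (\<epsilon> * real N - 1) \<le> \<mu> * real R" using R(2) \<mu>(1) by (intro mult_left_mono) auto
        then have \<mu>R: "\<mu> * (\<epsilon> * real N) \<le> \<mu> * real R + 1" using \<mu>(4) by (simp add: right_diff_distrib)
        have lo: "4 * real L * \<delta> * real N \<le> real R * \<alpha> / 2"
        proof -
          have "\<mu> * real R \<le> real R * \<alpha>" 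
            using mult_right_mono[OF \<mu>(2), of "real R"] by (simp only: mult.commute[of \<alpha>])
          then show ?thesis using \<mu>R big L3 unfolding L\<delta>N by linarith
        qed
        have hi: "real R * \<alpha> / 2 + 4 * real L * \<delta> * real N \<le> real ((R div L) * (L div 2))"
        proof -
          have "\<mu> * real R \<le> ((real L - 1) / real L - \<alpha>) * real R"
            using \<mu>(3) by (intro mult_right_mono) auto
          then have 1: "\<mu> * real R + real R * \<alpha> \<le> (real L - 1) / real L * real R"
            by (simp add: algebra_simps)
          have 2: "real (L div 2) = (real L - 1) / 2" using odd_L by (auto elim!: oddE)
          \<comment> \<open>The incomplete block costs at most \<open>(real L - 1) / 2\<close> of
            the capacity.\<close>
          have "real R / real L - 1 \<le> real (R div L)"
            using floor_divide_of_nat_eq[of R L, where 'a = real] by linarith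
          then have "(real R / real L - 1) * ((real L - 1) / 2) \<le> real (R div L) * ((real L - 1) / 2)"
            using L3 by (intro mult_right_mono) auto
          moreover have "(real R / real L - 1) * ((real L - 1) / 2)
              = (real L - 1) / real L * real R / 2 - (real L - 1) / 2"
            using L0 by (simp add: field_simps)
          ultimately have "(real L - 1) / real L * real R / 2 - (real L - 1) / 2 \<le> real ((R div L) * (L div 2))"
            by (simp only: of_nat_mult 2)
          \<comment> \<open>The arithmetic with products abstracted:
            \<open>A = real R * \<alpha>\<close>, \<open>B = \<mu> * real R\<close>,
            \<open>X = \<mu> * (\<epsilon> * real N)\<close>,
            \<open>U = (real L - 1) / real L * real R\<close>, and \<open>W\<close> is the
            capacity.\<close>
          moreover have "A / 2 + X / 4 \<le> W"
            if "U / 2 - (real L - 1) / 2 \<le> W" "B + A \<le> U" "X \<le> B + 1" "4 * real L \<le> X"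
            for A B U W X :: real
            using that L0 by (simp add: field_simps)
          ultimately show ?thesis using 1 \<mu>R big unfolding L\<delta>N by blast
        qed
        have "card (typical M \<delta>) \<le> partition_function L N n"
          unfolding N using Z n lo hi \<delta>0
          by (intro card_typical_le_partition_function) (auto simp: N)
        moreover have "exp (real M * (?H - real L * \<delta> * \<bar>ln y\<bar> / 2)) / 2 \<le> real (card (typical M \<delta>))"
          using \<delta>0 by (intro card_typical_ge \<delta>2 small) simp
        ultimately have "exp (real M * (?H - real L * \<delta> * \<bar>ln y\<bar> / 2)) / 2 \<le> real (partition_function L N n)"
          by (meson of_nat_mono order_trans)
        then have "ln (exp (real M * (?H - real L * \<delta> * \<bar>ln y\<bar> / 2)) / 2) \<le> ln (real (partition_function L N n))"
          using Z by (intro ln_mono) auto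
        then have Zge: "real M * (?H - real L * \<delta> * \<bar>ln y\<bar> / 2) - ln 2 \<le> ln (real (partition_function L N n))"
          by (simp add: ln_div)
        have "real L * \<delta> / 2 \<le> \<epsilon>" using L\<delta> \<mu>\<epsilon> \<epsilon> by linarith
        then have "real L * \<delta> / 2 * \<bar>ln y\<bar> \<le> \<epsilon> * \<bar>ln y\<bar>" by (rule mult_right_mono) simp
        then have "real M * (real L * \<delta> * \<bar>ln y\<bar> / 2) \<le> real M * (\<epsilon> * \<bar>ln y\<bar>)"
          by (intro mult_left_mono) (simp_all add: mult_ac)
        also have "\<dots> \<le> real N * (\<epsilon> * \<bar>ln y\<bar>)"
          using \<epsilon> by (intro mult_right_mono) (auto simp: N)
        finally have 1: "real M * (real L * \<delta> * \<bar>ln y\<bar> / 2) \<le> real N * (\<epsilon> * \<bar>ln y\<bar>)" .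
        have "real R * ?H \<le> real R * \<bar>?H\<bar>" by (intro mult_left_mono) auto
        also have "\<dots> \<le> \<epsilon> * real N * \<bar>?H\<bar>" using R(1) by (intro mult_right_mono) auto
        finally have 2: "real R * ?H \<le> real N * (\<epsilon> * \<bar>?H\<bar>)" by (simp add: mult_ac)
        have 3: "real N * ?H = real M * ?H + real R * ?H" by (simp add: N algebra_simps)
        have "real N * (?H - \<epsilon> * (\<bar>?H\<bar> + \<bar>ln y\<bar>))
            = real N * ?H - real N * (\<epsilon> * \<bar>?H\<bar>) - real N * (\<epsilon> * \<bar>ln y\<bar>)"
          by (simp add: algebra_simps)
        moreover have "real M * (?H - real L * \<delta> * \<bar>ln y\<bar> / 2) = real M * ?H - real M * (real L * \<delta> * \<bar>ln y\<bar> / 2)"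
          by (simp add: right_diff_distrib)
        ultimately show "real N * (?H - \<epsilon> * (\<bar>?H\<bar> + \<bar>ln y\<bar>)) - ln 2 \<le> ln (real (partition_function L N n))"
          using 1 2 3 Zge by linarith
      qed
    qed
  qed
qed

section \<open>The limit along the growth filter\<close>

lemma growth_filter_tendsto:
  assumes "i \<in> {1..L}"
  shows "((\<lambda>(N, n). real (n i) / real N) \<longlongrightarrow> \<alpha>) (growth_filter L \<alpha>)"
proof -
  have "growth_filter L \<alpha> \<le> filtercomap (\<lambda>(N, n). real (n i) / real N) (nhds \<alpha>)"
    unfolding growth_filter_def using assms by (intro le_infI1 le_infI2 INF_lower2[of i]) auto
  then show ?thesis by (simp add: filterlim_iff_le_filtercomap)
qed

lemma growth_filter_fst: "filterlim fst at_top (growth_filter L \<alpha>)"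
proof -
  have "growth_filter L \<alpha> \<le> filtercomap fst at_top"
    unfolding growth_filter_def by (intro le_infI1) auto
  then show ?thesis by (simp add: filterlim_iff_le_filtercomap)
qed

lemma growth_filter_pos: "\<forall>\<^sub>F (N, n) in growth_filter L \<alpha>. 0 < partition_function L N n"
proof -
  have "growth_filter L \<alpha> \<le> principal {(N, n). 0 < partition_function L N n}"
    unfolding growth_filter_def by (rule inf_le2)
  then show ?thesis by (simp add: le_principal case_prod_unfold)
qed

lemma typical_nonempty:
  assumes "0 \<le> \<delta>" "\<delta> \<le> 2" "2 * real L * exp (- \<delta>\<^sup>2 / 4 * real M) \<le> 1 / 2"
  shows "typical M \<delta> \<noteq> {}"
proof
  assume "typical M \<delta> = {}"
  then show False using card_typical_ge[OF assms] by (simp add: not_le[symmetric])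
qed

text \<open>The value of \<open>Lim\<close> is determined only along a nontrivial filter. Typical
  sequences whose tolerance tends to \<open>0\<close> provide admissible pairs for all large
  \<open>N\<close>.\<close>

lemma growth_filter_nontrivial: "growth_filter L \<alpha> \<noteq> bot"
proof -
  \<comment> \<open>The tolerance \<open>N^(-1/4)\<close> tends to \<open>0\<close>, yet slowly
    enough that \<open>(d N)^2 * real N = sqrt (real N)\<close> tends to infinity and the Chernoff
    error vanishes.\<close>
  define d where "d N = 1 / sqrt (sqrt (real N))" for N
  have "filterlim (\<lambda>N. sqrt (real N)) at_top sequentially"
    by (rule filterlim_compose[OF sqrt_at_top filterlim_real_sequentially])
  note sq = this filterlim_compose[OF sqrt_at_top this]
  have d_lim: "d \<longlonglongrightarrow> 0"
    unfolding d_def using tendsto_divide_0[OF tendsto_const filterlim_at_top_imp_at_infinity[OF sq(2)]] by simp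
  have "filterlim (\<lambda>N. 1 / 4 * sqrt (real N)) at_top sequentially"
    by (rule filterlim_tendsto_pos_mult_at_top[OF tendsto_const _ sq(1)]) simp
  from filterlim_compose[OF exp_at_bot filterlim_compose[OF filterlim_uminus_at_bot_at_top this]]
  have "(\<lambda>N. exp (- (1 / 4 * sqrt (real N)))) \<longlonglongrightarrow> 0" .
  from tendsto_mult[OF tendsto_const this, of "2 * real L"]
  have "(\<lambda>N. 2 * real L * exp (- (1 / 4 * sqrt (real N)))) \<longlonglongrightarrow> 0" by simp
  then have ev: "\<forall>\<^sub>F N in sequentially. 2 * real L * exp (- (1 / 4 * sqrt (real N))) < 1 / 2"
    by (rule order_tendstoD) simp
  have ev_typ: "\<forall>\<^sub>F N in sequentially. typical N (d N) \<noteq> {}"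
    using ev eventually_gt_at_top[of 0]
  proof eventually_elim
    case (elim N)
    have "1 \<le> sqrt (sqrt (real N))" using elim(2) by simp
    then have "d N \<le> 1" "0 \<le> d N" by (simp_all add: d_def)
    then have d2: "0 \<le> d N" "d N \<le> 2" by linarith+
    have "(d N)\<^sup>2 * real N = real N / sqrt (real N)"
      by (simp add: d_def power_divide)
    also have "\<dots> = sqrt (real N)" by (simp add: real_div_sqrt)
    finally have "- (d N)\<^sup>2 / 4 * real N = - (1 / 4 * sqrt (real N))" by simp
    then show ?case using elim(1) by (intro typical_nonempty d2) simp
  qed
  define m where "m N = (SOME m. m \<in> typical N (d N))" for N
  have ev_m: "\<forall>\<^sub>F N in sequentially. m N \<in> typical N (d N)"
    using ev_typ by eventually_elim (simp add: m_def some_in_eq)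
  \<comment> \<open>The vertex counts of the chosen sequence serve as \<open>n\<close>, so that the
    sequence itself is a multiweb for them.\<close>
  define F where "F N = (N, \<lambda>i. \<Sum>k=1..N. tile_mult L (m N k) i)" for N
  have "filterlim F (growth_filter L \<alpha>) sequentially"
    unfolding growth_filter_def filterlim_inf filterlim_INF filterlim_filtercomap_iff filterlim_principal
  proof (intro conjI ballI)
    show "filterlim (fst \<circ> F) at_top sequentially" by (simp add: F_def o_def filterlim_ident)
  next
    fix i assume i: "i \<in> {1..L}"
    have "\<forall>\<^sub>F N in sequentially. norm (real (\<Sum>k=1..N. tile_mult L (m N k) i) / real N - \<alpha>) \<le> d N"
      using ev_m eventually_gt_at_top[of 0]
    proof eventually_elim
      case (elim N)
      have "\<bar>(\<Sum>k=1..N. real (tile_mult L (m N k) i)) - real N * \<alpha>\<bar> \<le> d N * real N"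
        using elim(1) i by (auto simp: typical_def)
      then have "\<bar>(\<Sum>k=1..N. real (tile_mult L (m N k) i)) - real N * \<alpha>\<bar> / real N \<le> d N"
        using elim(2) by (simp add: divide_le_eq)
      moreover have "\<bar>(\<Sum>k=1..N. real (tile_mult L (m N k) i)) - real N * \<alpha>\<bar> / real N
          = \<bar>((\<Sum>k=1..N. real (tile_mult L (m N k) i)) - real N * \<alpha>) / real N\<bar>" by simp
      moreover have "((\<Sum>k=1..N. real (tile_mult L (m N k) i)) - real N * \<alpha>) / real N
          = real (\<Sum>k=1..N. tile_mult L (m N k) i) / real N - \<alpha>"
        using elim(2) by (simp add: diff_divide_distrib)
      ultimately show ?case by (simp only: real_norm_def)
    qed
    then have "\<forall>\<^sub>F N in sequentially.
        norm (real (\<Sum>k=1..N. tile_mult L (m N k) i) / real N - \<alpha>) \<le> norm (d N) * 1"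
      by (rule eventually_mono) (use abs_ge_self order_trans in \<open>fastforce simp only: mult_1_right real_norm_def\<close>)
    then have "(\<lambda>N. real (\<Sum>k=1..N. tile_mult L (m N k) i) / real N - \<alpha>) \<longlonglongrightarrow> 0"
      by (rule tendsto_0_le[OF d_lim])
    then show "filterlim ((\<lambda>(N, n). real (n i) / real N) \<circ> F) (nhds \<alpha>) sequentially"
      by (simp add: F_def o_def LIM_zero_iff)
  next
    show "\<forall>\<^sub>F N in sequentially. F N \<in> {(N, n). 0 < partition_function L N n}"
      using ev_m
    proof eventually_elim
      case (elim N)
      have "m N \<in> multiwebs L N (\<lambda>i. \<Sum>k=1..N. tile_mult L (m N k) i)"
        using elim by (simp add: multiwebs_def typical_def)
      then show ?case
        using finite_multiwebs by (auto simp: F_def partition_function_def card_gt_0_iff)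
    qed
  qed
  then have "filtermap F sequentially \<le> growth_filter L \<alpha>" by (simp add: filterlim_def)
  then show ?thesis by (metis bot.extremum_uniqueI filtermap_bot_iff sequentially_bot)
qed

lemma growth_rate_eq: "growth_rate L \<alpha> = entropy_rate L \<alpha> y"
proof -
  let ?H = "entropy_rate L \<alpha> y" and ?F = "growth_filter L \<alpha>"
  let ?f = "\<lambda>(N, n). ln (real (partition_function L N n)) / real N"
  have ev_N: "\<forall>\<^sub>F p in ?F. P (fst p)" if "\<forall>\<^sub>F N in sequentially. P N" for P
    using growth_filter_fst that by (rule eventually_compose_filterlim[rotated])
  have "(?f \<longlongrightarrow> ?H) ?F"
  proof (rule order_tendstoI)
    fix a assume a: "?H < a"
    have "((\<lambda>p. ln (matching_poly L y) - (\<Sum>i=1..L. (case p of (N, n) \<Rightarrow> real (n i) / real N)) / 2 * ln y)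
        \<longlongrightarrow> ln (matching_poly L y) - (\<Sum>i=1..L. \<alpha>) / 2 * ln y) ?F"
      by (intro tendsto_intros growth_filter_tendsto) auto
    then have "((\<lambda>p. ln (matching_poly L y) - (\<Sum>i=1..L. (case p of (N, n) \<Rightarrow> real (n i) / real N)) / 2 * ln y)
        \<longlongrightarrow> ?H) ?F"
      by (simp add: entropy_rate_def)
    from order_tendstoD(2)[OF this a] growth_filter_pos ev_N[OF eventually_gt_at_top[of 0]]
    show "\<forall>\<^sub>F p in ?F. ?f p < a"
    proof eventually_elim
      case (elim p)
      obtain N n where p: "p = (N, n)" by (cases p)
      have N: "0 < real N" using elim(3) by (simp add: p)
      have "ln (real (partition_function L N n)) / real N
          \<le> (real N * ln (matching_poly L y) - (\<Sum>i=1..L. real (n i)) / 2 * ln y) / real N"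
        using elim(2) N by (intro divide_right_mono ln_partition_function_le) (auto simp: p)
      also have "\<dots> = ln (matching_poly L y) - (\<Sum>i=1..L. real (n i) / real N) / 2 * ln y"
        using N by (simp add: diff_divide_distrib sum_divide_distrib[symmetric])
      finally show ?case using elim(1) by (simp add: p)
    qed
  next
    fix a assume a: "a < ?H"
    \<comment> \<open>The summand \<open>1\<close> keeps the divisor positive. With this
      \<open>\<epsilon>\<close> the loss per position is at most half of \<open>?H - a\<close>; the
      other half outweighs \<open>ln 2\<close> for large \<open>N\<close>.\<close>
    define K where "K = \<bar>?H\<bar> + \<bar>ln y\<bar> + 1"
    define \<epsilon> where "\<epsilon> = min (1 / 2) ((?H - a) / (2 * K))"
    have K: "1 \<le> K" by (simp add: K_def)
    have \<epsilon>: "0 < \<epsilon>" "\<epsilon> < 1" "\<epsilon> \<le> (?H - a) / (2 * K)"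
      using a K by (auto simp: \<epsilon>_def)
    have \<epsilon>K: "\<epsilon> * (\<bar>?H\<bar> + \<bar>ln y\<bar>) \<le> (?H - a) / 2"
    proof -
      have "\<epsilon> * (\<bar>?H\<bar> + \<bar>ln y\<bar>) \<le> \<epsilon> * K" using \<epsilon> by (intro mult_left_mono) (auto simp: K_def)
      also have "\<dots> \<le> (?H - a) / (2 * K) * K" using \<epsilon>(3) K by (intro mult_right_mono) auto
      also have "\<dots> = (?H - a) / 2" using K by simp
      finally show ?thesis .
    qed
    obtain \<delta> where \<delta>: "0 < \<delta>" and lower: "\<forall>\<^sub>F N in sequentially. \<forall>n. 0 < partition_function L N n \<longrightarrow>
        (\<forall>i\<in>{1..L}. \<bar>real (n i) - real N * \<alpha>\<bar> \<le> \<delta> * real N) \<longrightarrow>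
        real N * (?H - \<epsilon> * (\<bar>?H\<bar> + \<bar>ln y\<bar>)) - ln 2 \<le> ln (real (partition_function L N n))"
      using ln_partition_function_ge[OF \<epsilon>(1,2)] by blast
    have close: "\<forall>\<^sub>F p in ?F. \<forall>i\<in>{1..L}. dist (case p of (N, n) \<Rightarrow> real (n i) / real N) \<alpha> < \<delta>"
      using tendstoD[OF growth_filter_tendsto \<delta>] by (intro eventually_ball_finite ballI) auto
    have large: "\<forall>\<^sub>F N in sequentially. 2 * ln 2 / (?H - a) < real N"
      using filterlim_real_sequentially by (simp add: filterlim_at_top_dense)
    from close growth_filter_pos ev_N[OF lower] ev_N[OF eventually_gt_at_top[of 0]] ev_N[OF large]
    show "\<forall>\<^sub>F p in ?F. a < ?f p"
    proof eventually_elim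
      case (elim p)
      obtain N n where p: "p = (N, n)" by (cases p)
      have N: "0 < real N" using elim(4) by (simp add: p)
      have "\<bar>real (n i) - real N * \<alpha>\<bar> \<le> \<delta> * real N" if "i \<in> {1..L}" for i
      proof -
        have "\<bar>real (n i) / real N - \<alpha>\<bar> < \<delta>" using elim(1) that by (auto simp: p dist_real_def)
        then have "\<bar>real (n i) / real N - \<alpha>\<bar> * real N \<le> \<delta> * real N" using N by simp
        moreover have "\<bar>real (n i) / real N - \<alpha>\<bar> * real N = \<bar>(real (n i) / real N - \<alpha>) * real N\<bar>"
          by (simp add: abs_mult)
        moreover have "(real (n i) / real N - \<alpha>) * real N = real (n i) - real N * \<alpha>"
          using N by (simp add: field_simps)
        ultimately show ?thesis by simp
      qed
      then have ge: "real N * (?H - \<epsilon> * (\<bar>?H\<bar> + \<bar>ln y\<bar>)) - ln 2 \<le> ln (real (partition_function L N n))"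
        using elim(2,3) by (simp add: p)
      have prems: "2 * ln 2 < real N * (?H - a)"
        "real N * ((?H - a) / 2) \<le> real N * ((?H - a) - \<epsilon> * (\<bar>?H\<bar> + \<bar>ln y\<bar>))"
        subgoal using elim(5) a by (simp add: p divide_less_eq)
        subgoal using \<epsilon>K N by (intro mult_left_mono) auto
        done
      have "real N * a < real N * (?H - \<epsilon> * (\<bar>?H\<bar> + \<bar>ln y\<bar>)) - ln 2"
      proof -
        have "real N * ((?H - a) / 2) = real N * (?H - a) / 2" by simp
        moreover have "real N * ((?H - a) - \<epsilon> * (\<bar>?H\<bar> + \<bar>ln y\<bar>))
            = real N * (?H - \<epsilon> * (\<bar>?H\<bar> + \<bar>ln y\<bar>)) - real N * a"
          by (simp add: algebra_simps)
        ultimately show ?thesis using prems by linarith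
      qed
      then have "a * real N < ln (real (partition_function L N n))" using ge by (simp add: mult.commute)
      then show ?case using N by (simp add: p less_divide_eq)
    qed
  qed
  then show ?thesis unfolding growth_rate_def by (rule tendsto_Lim[OF growth_filter_nontrivial])
qed

end

section \<open>Critical weights and the maximal growth rate\<close>

context tile_activity
begin

text \<open>The Gibbs distribution with activity \<open>y\<close>, restricted to tiles because
  critical weights live in the extensional function space.\<close>

definition boltzmann :: "nat set set \<Rightarrow> real" where
  "boltzmann = (\<lambda>t\<in>tiles L. y ^ card t / matching_poly L y)"

lemma boltzmann_pos: "t \<in> tiles L \<Longrightarrow> 0 < boltzmann t"
  using y_pos matching_poly_pos by (simp add: boltzmann_def)

lemma sum_boltzmann: "(\<Sum>t\<in>tiles L. boltzmann t) = 1"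
proof -
  have "(\<Sum>t\<in>tiles L. boltzmann t) = (\<Sum>t\<in>tiles L. y ^ card t) / matching_poly L y"
    by (simp add: boltzmann_def sum_divide_distrib)
  then show ?thesis using matching_poly_pos by (simp add: matching_poly_def)
qed

lemma sum_mult_boltzmann:
  assumes "v \<in> {1..L}"
  shows "(\<Sum>t\<in>tiles L. real (tile_mult L t v) * boltzmann t) = \<alpha>"
proof -
  have "(\<Sum>t\<in>tiles L. real (tile_mult L t v) * boltzmann t)
      = (\<Sum>t\<in>tiles L. real (tile_mult L t v) * y ^ card t) / matching_poly L y"
    by (simp add: boltzmann_def sum_divide_distrib)
  then show ?thesis using matching_poly_pos activity[OF assms] by simp
qed

lemma sum_card_boltzmann: "(\<Sum>t\<in>tiles L. 2 * real (card t) * boltzmann t) = real L * \<alpha>"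
proof -
  have "(\<Sum>t\<in>tiles L. 2 * real (card t) * boltzmann t)
      = (\<Sum>t\<in>tiles L. 2 * real (card t) * (y ^ card t / matching_poly L y))"
    by (intro sum.cong) (simp_all add: boltzmann_def)
  also have "\<dots> = real L * (\<Sum>t\<in>tiles L. real (tile_mult L t 1) * (y ^ card t / matching_poly L y))"
    using L3 by (intro sum_tile_mult_eq_average[OF L3, symmetric]) auto
  also have "(\<Sum>t\<in>tiles L. real (tile_mult L t 1) * (y ^ card t / matching_poly L y))
      = (\<Sum>t\<in>tiles L. real (tile_mult L t 1) * boltzmann t)"
    by (intro sum.cong) (simp_all add: boltzmann_def)
  also have "\<dots> = \<alpha>" using L3 by (intro sum_mult_boltzmann) auto
  finally show ?thesis .
qed

text \<open>A factor \<open>sqrt y\<close> at each of the \<open>2 * card t\<close> covered vertices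
  yields \<open>y ^ card t\<close>. The factor \<open>c\<close> at all vertices, \<open>0\<close>
  included, yields \<open>c ^ L\<close> because every tile has total multiplicity \<open>L\<close>,
  and this normalises.\<close>

lemma gauge_equivalent_boltzmann: "gauge_equivalent L (\<lambda>_. 1) boltzmann"
proof -
  define c where "c = root L (1 / matching_poly L y)"
  have c: "0 < c" "c ^ L = 1 / matching_poly L y"
    using matching_poly_pos L3 by (auto simp: c_def)
  define f where "f i = (if i = 0 then c else c * sqrt y)" for i :: nat
  have "boltzmann t = (\<Prod>i=0..L. f i ^ tile_mult L t i)" if t: "t \<in> tiles L" for t
  proof -
    have "{0..L} = insert 0 {1..L}" by auto
    then have "(\<Prod>i=0..L. f i ^ tile_mult L t i)
        = c ^ (L - 2 * card t) * (\<Prod>i=1..L. f i ^ tile_mult L t i)"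
      by (simp add: f_def tile_mult_def)
    also have "(\<Prod>i=1..L. f i ^ tile_mult L t i) = (\<Prod>i=1..L. (c * sqrt y) ^ tile_mult L t i)"
      by (intro prod.cong) (auto simp: f_def)
    also have "\<dots> = (c * sqrt y) ^ (\<Sum>i=1..L. tile_mult L t i)"
      by (rule power_sum[symmetric])
    also have "\<dots> = (c * sqrt y) ^ (2 * card t)"
      by (simp only: sum_tile_mult[OF L3 t])
    also have "\<dots> = c ^ (2 * card t) * y ^ card t"
      using y_pos by (simp add: power_mult_distrib power_mult)
    also have "c ^ (L - 2 * card t) * (c ^ (2 * card t) * y ^ card t) = c ^ L * y ^ card t"
      using card_tile_le[OF L3 t] by (simp add: power_add[symmetric] mult.assoc[symmetric])
    finally show ?thesis using t by (simp add: boltzmann_def c(2))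
  qed
  moreover have "0 < f i" for i using c y_pos by (simp add: f_def)
  ultimately show ?thesis unfolding gauge_equivalent_def by (intro exI[of _ f]) simp
qed

lemma is_critical_weight_boltzmann: "is_critical_weight L \<alpha> boltzmann"
  unfolding is_critical_weight_def
proof (intro conjI ballI gauge_equivalent_boltzmann)
  show "boltzmann \<in> tiles L \<rightarrow>\<^sub>E {0<..}"
  proof (rule PiE_I)
    show "boltzmann t \<in> {0<..}" if "t \<in> tiles L" for t using boltzmann_pos[OF that] by simp
    show "boltzmann t = undefined" if "t \<notin> tiles L" for t using that by (simp add: boltzmann_def)
  qed
  fix i assume i: "i \<in> {0..L}"
  show "(\<Sum>t\<in>tiles L. real (tile_mult L t i) * boltzmann t) = density L \<alpha> i"
  proof (cases "i = 0")
    case True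
    have "(\<Sum>t\<in>tiles L. real (tile_mult L t i) * boltzmann t)
        = (\<Sum>t\<in>tiles L. real L * boltzmann t - 2 * real (card t) * boltzmann t)"
      using True card_tile_le[OF L3]
      by (intro sum.cong refl) (simp add: tile_mult_def of_nat_diff left_diff_distrib)
    also have "\<dots> = real L * (\<Sum>t\<in>tiles L. boltzmann t) - (\<Sum>t\<in>tiles L. 2 * real (card t) * boltzmann t)"
      by (simp only: sum_subtractf sum_distrib_left)
    finally show ?thesis
      using True by (simp only: sum_boltzmann sum_card_boltzmann density_def) (simp add: right_diff_distrib)
  next
    case False
    then show ?thesis using sum_mult_boltzmann[of i] i by (simp add: density_def)
  qed
qed

end

text \<open>Convexity: the symmetrised relative entropy of two gauge equivalent weights depends only
  on the difference of their vertex densities.\<close>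

lemma critical_weight_unique:
  assumes L3: "3 \<le> L" and w: "is_critical_weight L \<alpha> w" and w': "is_critical_weight L \<alpha> w'"
  shows "w = w'"
proof -
  have wP: "w \<in> tiles L \<rightarrow>\<^sub>E {0<..}" "w' \<in> tiles L \<rightarrow>\<^sub>E {0<..}"
    and dens: "\<And>i. i \<in> {0..L} \<Longrightarrow> (\<Sum>t\<in>tiles L. real (tile_mult L t i) * w t) = density L \<alpha> i"
      "\<And>i. i \<in> {0..L} \<Longrightarrow> (\<Sum>t\<in>tiles L. real (tile_mult L t i) * w' t) = density L \<alpha> i"
    using w w' by (auto simp: is_critical_weight_def)
  obtain f where "\<forall>i\<in>{0..L}. 0 < f i"
      "\<forall>t\<in>tiles L. w t = 1 * (\<Prod>i=0..L. f i ^ tile_mult L t i)"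
    using w unfolding is_critical_weight_def gauge_equivalent_def by blast
  then have f: "\<And>i. i \<in> {0..L} \<Longrightarrow> 0 < f i"
      "\<And>t. t \<in> tiles L \<Longrightarrow> w t = (\<Prod>i=0..L. f i ^ tile_mult L t i)"
    by simp_all
  obtain f' where "\<forall>i\<in>{0..L}. 0 < f' i"
      "\<forall>t\<in>tiles L. w' t = 1 * (\<Prod>i=0..L. f' i ^ tile_mult L t i)"
    using w' unfolding is_critical_weight_def gauge_equivalent_def by blast
  then have f': "\<And>i. i \<in> {0..L} \<Longrightarrow> 0 < f' i"
      "\<And>t. t \<in> tiles L \<Longrightarrow> w' t = (\<Prod>i=0..L. f' i ^ tile_mult L t i)"
    by simp_all
  have ln_prod_power: "ln (\<Prod>i=0..L. g i ^ e i) = (\<Sum>i=0..L. real (e i) * ln (g i))"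
    if g: "\<And>i. i \<in> {0..L} \<Longrightarrow> 0 < g i" for g :: "nat \<Rightarrow> real" and e :: "nat \<Rightarrow> nat"
  proof -
    have "g i ^ e i \<noteq> 0" if "i \<in> {0..L}" for i using g[OF that] by simp
    then have "ln (\<Prod>i=0..L. g i ^ e i) = (\<Sum>i=0..L. ln (g i ^ e i))"
      by (intro ln_prod) (use g in \<open>auto simp: zero_less_power\<close>)
    also have "\<dots> = (\<Sum>i=0..L. real (e i) * ln (g i))"
      by (intro sum.cong refl ln_realpow g)
    finally show ?thesis .
  qed
  let ?d = "\<lambda>t. (w t - w' t) * (ln (w t) - ln (w' t))"
  have pos: "0 < w t" "0 < w' t" if "t \<in> tiles L" for t
    using PiE_mem[OF wP(1) that] PiE_mem[OF wP(2) that] by auto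
  \<comment> \<open>By gauge equivalence \<open>ln (w t) - ln (w' t)\<close> is linear in the
    multiplicities, so exchanging the sums leaves differences of equal densities.\<close>
  have "(\<Sum>t\<in>tiles L. ?d t)
      = (\<Sum>t\<in>tiles L. \<Sum>i=0..L. (ln (f i) - ln (f' i)) * (real (tile_mult L t i) * w t - real (tile_mult L t i) * w' t))"
  proof (intro sum.cong refl)
    fix t assume t: "t \<in> tiles L"
    have "ln (w t) = (\<Sum>i=0..L. real (tile_mult L t i) * ln (f i))"
      unfolding f(2)[OF t] by (rule ln_prod_power) (rule f(1))
    moreover have "ln (w' t) = (\<Sum>i=0..L. real (tile_mult L t i) * ln (f' i))"
      unfolding f'(2)[OF t] by (rule ln_prod_power) (rule f'(1))
    ultimately have "ln (w t) - ln (w' t) = (\<Sum>i=0..L. real (tile_mult L t i) * (ln (f i) - ln (f' i)))"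
      by (simp only: sum_subtractf right_diff_distrib)
    then show "?d t = (\<Sum>i=0..L. (ln (f i) - ln (f' i)) * (real (tile_mult L t i) * w t - real (tile_mult L t i) * w' t))"
      by (simp add: sum_distrib_left algebra_simps)
  qed
  also have "\<dots> = (\<Sum>i=0..L. \<Sum>t\<in>tiles L. (ln (f i) - ln (f' i)) * (real (tile_mult L t i) * w t - real (tile_mult L t i) * w' t))"
    by (rule sum.swap)
  also have "\<dots> = (\<Sum>i=0..L. (ln (f i) - ln (f' i)) * (density L \<alpha> i - density L \<alpha> i))"
    by (intro sum.cong refl) (simp only: sum_distrib_left[symmetric] sum_subtractf dens)
  also have "\<dots> = 0" by simp
  finally have zero: "(\<Sum>t\<in>tiles L. ?d t) = 0" .
  \<comment> \<open>Monotonicity of \<open>ln\<close>; strictness makes a summand vanish only if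
    \<open>w t = w' t\<close>.\<close>
  have nonneg: "0 \<le> ?d t" if "t \<in> tiles L" for t
    using pos[OF that] by (cases "w t \<le> w' t") (auto intro: mult_nonneg_nonneg mult_nonpos_nonpos)
  have "w t = w' t" if t: "t \<in> tiles L" for t
  proof -
    have "?d t = 0"
      using sum_nonneg_eq_0_iff[OF finite_tiles[OF L3], of ?d] zero nonneg t by blast
    then show ?thesis using pos[OF t] by auto
  qed
  then show ?thesis using wP by (intro PiE_ext) auto
qed

context tile_activity
begin

lemma critical_weight_eq: "critical_weight L \<alpha> = boltzmann"
  unfolding critical_weight_def
proof (rule the_equality)
  show "is_critical_weight L \<alpha> boltzmann" by (rule is_critical_weight_boltzmann)
  show "w = boltzmann" if "is_critical_weight L \<alpha> w" for w
    using L3 that is_critical_weight_boltzmann by (rule critical_weight_unique)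
qed

lemma critical_distribution_uniform_iff: "critical_distribution_uniform L \<alpha> \<longleftrightarrow> y = 1"
proof
  assume "critical_distribution_uniform L \<alpha>"
  then have "boltzmann {} = boltzmann {{1, 2}}"
    using empty_in_tiles[OF L3] singleton_in_tiles[OF L3]
    by (auto simp: critical_distribution_uniform_def critical_weight_eq)
  then show "y = 1"
    using empty_in_tiles[OF L3] singleton_in_tiles[OF L3] matching_poly_pos
    by (simp add: boltzmann_def)
next
  assume "y = 1"
  then show "critical_distribution_uniform L \<alpha>"
    unfolding critical_distribution_uniform_def critical_weight_eq boltzmann_def
    by (intro exI[of _ "1 / matching_poly L y"]) simp
qed

lemma density_eq_fib:
  assumes "y = 1"
  shows "\<alpha> = 2 * real (fib (L - 1)) / real (fib (L + 1) + fib (L - 1))"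
proof -
  have "2 * real (fib (L - 1)) = \<alpha> * real (card (tiles L))"
    using activity[of 1] sum_tile_mult_fib[OF L3, of 1] L3 assms by (simp add: matching_poly_def)
  moreover have "0 < card (tiles L)"
    using empty_in_tiles[OF L3] finite_tiles[OF L3] by (auto simp: card_gt_0_iff)
  ultimately have "\<alpha> = 2 * real (fib (L - 1)) / real (card (tiles L))" by (simp add: eq_divide_eq)
  then show ?thesis by (simp only: card_tiles[OF L3])
qed

text \<open>Gibbs' inequality against the uniform distribution: \<open>?r t\<close> is the ratio of
  the uniform weight to \<open>boltzmann t\<close>, and \<open>ln r \<le> r - 1\<close> with
  equality only at \<open>r = 1\<close>.\<close>

lemma entropy_rate_le: "entropy_rate L \<alpha> y \<le> ln (real (card (tiles L)))" (is "_ \<le> ln ?n")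
  and entropy_rate_less: "y \<noteq> 1 \<Longrightarrow> entropy_rate L \<alpha> y < ln (real (card (tiles L)))"
proof -
  let ?Q = "matching_poly L y"
  let ?r = "\<lambda>t. 1 / (boltzmann t * ?n)"
  note fT = finite_tiles[OF L3]
  have n: "0 < ?n" using empty_in_tiles[OF L3] fT by (auto simp: card_gt_0_iff)
  have ln_r: "ln (?r t) = ln ?Q - real (card t) * ln y - ln ?n" if "t \<in> tiles L" for t
    using that n y_pos matching_poly_pos
    by (simp add: boltzmann_def ln_div ln_mult ln_realpow)
  have "(\<Sum>t\<in>tiles L. boltzmann t * ln (?r t))
      = (\<Sum>t\<in>tiles L. (ln ?Q - ln ?n) * boltzmann t - ln y / 2 * (2 * real (card t) * boltzmann t))"
  proof (intro sum.cong refl)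
    fix t assume t: "t \<in> tiles L"
    show "boltzmann t * ln (?r t)
        = (ln ?Q - ln ?n) * boltzmann t - ln y / 2 * (2 * real (card t) * boltzmann t)"
      unfolding ln_r[OF t] by (simp add: algebra_simps)
  qed
  also have "\<dots> = (ln ?Q - ln ?n) * (\<Sum>t\<in>tiles L. boltzmann t)
      - ln y / 2 * (\<Sum>t\<in>tiles L. 2 * real (card t) * boltzmann t)"
    by (simp only: sum_subtractf sum_distrib_left)
  also have "\<dots> = entropy_rate L \<alpha> y - ln ?n"
    unfolding sum_boltzmann sum_card_boltzmann by (simp add: entropy_rate_def)
  finally have lhs: "(\<Sum>t\<in>tiles L. boltzmann t * ln (?r t)) = entropy_rate L \<alpha> y - ln ?n" .
  have "(\<Sum>t\<in>tiles L. boltzmann t * (?r t - 1)) = (\<Sum>t\<in>tiles L. 1 / ?n - boltzmann t)"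
    using boltzmann_pos by (intro sum.cong refl) (simp add: field_simps less_imp_neq[symmetric])
  also have "\<dots> = 0" using n by (simp add: sum_subtractf sum_boltzmann)
  finally have rhs: "(\<Sum>t\<in>tiles L. boltzmann t * (?r t - 1)) = 0" .
  have r_pos: "0 < ?r t" if "t \<in> tiles L" for t using boltzmann_pos[OF that] n by simp
  have le: "boltzmann t * ln (?r t) \<le> boltzmann t * (?r t - 1)" if "t \<in> tiles L" for t
    using boltzmann_pos[OF that] ln_le_minus_one[OF r_pos[OF that]] by (intro mult_left_mono) auto
  show "entropy_rate L \<alpha> y \<le> ln ?n"
  proof -
    have "(\<Sum>t\<in>tiles L. boltzmann t * ln (?r t)) \<le> (\<Sum>t\<in>tiles L. boltzmann t * (?r t - 1))"
      by (intro sum_mono le)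
    then show ?thesis unfolding lhs rhs by simp
  qed
  assume y1: "y \<noteq> 1"
  have "\<exists>t\<in>tiles L. ?r t \<noteq> 1"
  proof (rule ccontr)
    assume "\<not> ?thesis"
    then have "?r {} = ?r {{1, 2}}"
      using empty_in_tiles[OF L3] singleton_in_tiles[OF L3] by simp
    then have "boltzmann {} = boltzmann {{1, 2}}" using n by simp
    then show False
      using y1 empty_in_tiles[OF L3] singleton_in_tiles[OF L3] matching_poly_pos
      by (simp add: boltzmann_def)
  qed
  then obtain t where t: "t \<in> tiles L" "?r t \<noteq> 1" by blast
  have "ln (?r t) < ?r t - 1"
    using ln_le_minus_one[OF r_pos[OF t(1)]] ln_eq_minus_one[OF r_pos[OF t(1)]] t(2) by linarith
  then have "boltzmann t * ln (?r t) < boltzmann t * (?r t - 1)"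
    using boltzmann_pos[OF t(1)] by (intro mult_strict_left_mono)
  then have "(\<Sum>t\<in>tiles L. boltzmann t * ln (?r t)) < (\<Sum>t\<in>tiles L. boltzmann t * (?r t - 1))"
    using le t(1) by (intro sum_strict_mono_ex1[OF fT]) auto
  then show "entropy_rate L \<alpha> y < ln ?n" unfolding lhs rhs by simp
qed

end

lemma entropy_rate_one: "entropy_rate L \<alpha> 1 = ln (real (card (tiles L)))"
  by (simp add: entropy_rate_def matching_poly_def)

section \<open>Attaining every feasible density\<close>

lemma exists_near_perfect_tile:
  assumes L3: "3 \<le> L" and odd: "odd L"
  shows "\<exists>t\<in>tiles L. card t = L div 2"
proof -
  let ?J = "{j. j < L \<and> odd j}"
  have "?J \<in> cyclic_matchings L"
    using odd by (auto simp: cyclic_matchings_def Suc_mod_eq split: if_splits)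
  moreover have "card ?J = L div 2"
  proof -
    have "?J = {j \<in> {0..<L}. odd j}" by auto
    then show ?thesis using sum_of_bool_odd[of L] by (simp add: of_bool_def sum.If_cases Int_def)
  qed
  ultimately show ?thesis using card_tile_of[OF L3] by (auto simp: tiles_eq[OF L3])
qed

text \<open>Up to the factor \<open>matching_poly L y\<close>, \<open>G y\<close> is the mean of
  \<open>2 * card t\<close> minus \<open>real L * \<alpha>\<close>. It changes sign, and rotation
  symmetry turns a zero into the density \<open>\<alpha>\<close> at every vertex.\<close>

lemma tile_activity_exists:
  assumes L3: "3 \<le> L" and odd: "odd L" and \<alpha>: "0 < \<alpha>" "\<alpha> < (real L - 1) / real L"
  shows "\<exists>y. tile_activity L \<alpha> y"
proof -
  let ?T = "tiles L" and ?h = "L div 2"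
  define G where "G y = (\<Sum>t\<in>?T. (2 * real (card t) - real L * \<alpha>) * y ^ card t)" for y
  note fT = finite_tiles[OF L3]
  have L0: "0 < real L" using L3 by simp
  have h: "2 * real ?h = real L - 1" "1 \<le> ?h" using odd L3 by (auto elim!: oddE)
  have gap: "0 < 2 * real ?h - real L * \<alpha>"
    using \<alpha>(2) L0 by (simp add: h(1) field_simps)
  have L\<alpha>: "0 < real L * \<alpha>" using L0 \<alpha>(1) by simp
  \<comment> \<open>Since \<open>0 ^ 0 = 1\<close>, only the empty tile contributes at
    \<open>0\<close>, with a negative coefficient.\<close>
  have "G 0 < (\<Sum>t\<in>?T. 0)"
    unfolding G_def
  proof (rule sum_strict_mono_ex1[OF fT])
    show "\<forall>t\<in>?T. (2 * real (card t) - real L * \<alpha>) * 0 ^ card t \<le> 0"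
    proof
      fix t show "(2 * real (card t) - real L * \<alpha>) * 0 ^ card t \<le> 0"
        using L\<alpha> by (cases "card t = 0") (auto simp: power_0_left)
    qed
    show "\<exists>t\<in>?T. (2 * real (card t) - real L * \<alpha>) * 0 ^ card t < 0"
      using L\<alpha> empty_in_tiles[OF L3] by (intro bexI[of _ "{}"]) auto
  qed
  then have G0: "G 0 < 0" by simp
  obtain t0 where t0: "t0 \<in> ?T" "card t0 = ?h"
    using exists_near_perfect_tile[OF L3 odd] by blast
  let ?n = "real (card ?T)"
  \<comment> \<open>At this point the near-perfect tile \<open>t0\<close> outweighs all negative
    terms: those have degree at most \<open>?h - 1\<close>, there are at most \<open>?n\<close> of
    them, and each is at least \<open>- (real L * \<alpha>) * Y ^ (?h - 1)\<close>.\<close>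
  define Y where "Y = max 1 (?n * (real L * \<alpha>) / (2 * real ?h - real L * \<alpha>))"
  have Y: "1 \<le> Y" "?n * (real L * \<alpha>) \<le> (2 * real ?h - real L * \<alpha>) * Y"
  proof -
    show "1 \<le> Y" by (simp add: Y_def)
    have "?n * (real L * \<alpha>) / (2 * real ?h - real L * \<alpha>) \<le> Y" by (simp add: Y_def)
    then show "?n * (real L * \<alpha>) \<le> (2 * real ?h - real L * \<alpha>) * Y"
      using gap by (simp only: pos_divide_le_eq mult.commute)
  qed
  have summand_ge: "- (real L * \<alpha>) * Y ^ (?h - 1) \<le> (2 * real (card t) - real L * \<alpha>) * Y ^ card t" for t :: "nat set set"
  proof (cases "real L * \<alpha> \<le> 2 * real (card t)")
    case True
    have "- (real L * \<alpha>) * Y ^ (?h - 1) \<le> 0" using L\<alpha> Y(1) by simp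
    also have "0 \<le> (2 * real (card t) - real L * \<alpha>) * Y ^ card t" using True Y(1) by simp
    finally show ?thesis .
  next
    case False
    then have "real (card t) < real ?h" using gap by linarith
    then have "card t \<le> ?h - 1" by simp
    then have "Y ^ card t \<le> Y ^ (?h - 1)" using Y(1) by (intro power_increasing)
    then have "real L * \<alpha> * Y ^ card t \<le> real L * \<alpha> * Y ^ (?h - 1)"
      using L\<alpha> by (intro mult_left_mono) auto
    moreover have "0 \<le> 2 * real (card t) * Y ^ card t" using Y(1) by simp
    ultimately show ?thesis by (simp add: left_diff_distrib)
  qed
  have "(2 * real ?h - real L * \<alpha>) * Y ^ ?h = (2 * real ?h - real L * \<alpha>) * Y * Y ^ (?h - 1)"
    using h(2) by (simp add: power_eq_if)
  moreover have "\<dots> \<ge> ?n * (real L * \<alpha>) * Y ^ (?h - 1)"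
    using Y by (intro mult_right_mono) auto
  moreover have "(\<Sum>t\<in>?T - {t0}. (2 * real (card t) - real L * \<alpha>) * Y ^ card t)
      \<ge> (\<Sum>t\<in>?T - {t0}. - (real L * \<alpha>) * Y ^ (?h - 1))"
    by (intro sum_mono summand_ge)
  moreover have "(\<Sum>t\<in>?T - {t0}. - (real L * \<alpha>) * Y ^ (?h - 1))
      \<ge> - (?n * (real L * \<alpha>) * Y ^ (?h - 1))"
  proof -
    have "real (card (?T - {t0})) \<le> ?n" using fT by (simp add: card_mono)
    then have "real (card (?T - {t0})) * (real L * \<alpha> * Y ^ (?h - 1)) \<le> ?n * (real L * \<alpha> * Y ^ (?h - 1))"
      using L\<alpha> Y(1) by (intro mult_right_mono) auto
    then show ?thesis by (simp add: mult.assoc)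
  qed
  moreover have "G Y = (2 * real ?h - real L * \<alpha>) * Y ^ ?h
      + (\<Sum>t\<in>?T - {t0}. (2 * real (card t) - real L * \<alpha>) * Y ^ card t)"
    using sum.remove[OF fT t0(1), of "\<lambda>t. (2 * real (card t) - real L * \<alpha>) * Y ^ card t"]
    by (simp only: G_def t0(2))
  ultimately have GY: "0 \<le> G Y" by linarith
  have "continuous_on {0..Y} G" unfolding G_def by (intro continuous_intros)
  then obtain y where y: "0 \<le> y" "G y = 0"
    using IVT'[of G 0 0 Y] G0 GY Y(1) by auto
  have y_pos: "0 < y" using y G0 by (cases "y = 0") auto
  have "tile_activity L \<alpha> y"
  proof
    fix v assume v: "v \<in> {1..L}"
    have "real L * (\<Sum>t\<in>?T. real (tile_mult L t v) * y ^ card t) = (\<Sum>t\<in>?T. 2 * real (card t) * y ^ card t)"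
      by (rule sum_tile_mult_eq_average[OF L3 v])
    also have "\<dots> = G y + real L * (\<alpha> * matching_poly L y)"
      by (simp add: G_def matching_poly_def sum_distrib_left sum.distrib[symmetric] algebra_simps)
    finally show "(\<Sum>t\<in>?T. real (tile_mult L t v) * y ^ card t) = \<alpha> * matching_poly L y"
      using L0 y(2) by simp
  qed (use assms y_pos in auto)
  then show ?thesis ..
qed

text \<open>The point to check is feasibility: for odd \<open>L\<close> every tile satisfies
  \<open>2 * card t \<le> L - 1\<close>, strictly for the empty one, so the mean over all tiles
  stays below \<open>L - 1\<close>.\<close>

lemma tile_activity_one:
  assumes L3: "3 \<le> L" and odd: "odd L"
  shows "tile_activity L (2 * real (fib (L - 1)) / real (fib (L + 1) + fib (L - 1))) 1"
proof -
  let ?T = "tiles L"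
  note fT = finite_tiles[OF L3]
  have "card ?T \<noteq> 0" using empty_in_tiles[OF L3] fT by auto
  then have n: "real (card ?T) = real (fib (L + 1) + fib (L - 1))" "0 < real (card ?T)"
    by (simp_all only: card_tiles[OF L3] of_nat_0_less_iff neq0_conv)
  define \<alpha> where "\<alpha> = 2 * real (fib (L - 1)) / real (card ?T)"
  have act: "(\<Sum>t\<in>?T. real (tile_mult L t v)) = \<alpha> * real (card ?T)" if "v \<in> {1..L}" for v
    using sum_tile_mult_fib[OF L3 that] n(2) by (simp add: \<alpha>_def)
  have card_le: "2 * real (card t) \<le> real L - 1" if "t \<in> ?T" for t
  proof -
    have "2 * card t \<noteq> L" using odd by auto
    then have "2 * card t + 1 \<le> L" using card_tile_le[OF L3 that] by simp
    then have "real (2 * card t + 1) \<le> real L" by (simp only: of_nat_le_iff)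
    then show ?thesis by simp
  qed
  have "real L * (\<alpha> * real (card ?T)) = (\<Sum>t\<in>?T. 2 * real (card t))"
    using sum_tile_mult_eq_average[OF L3, of 1 "\<lambda>_. 1"] act[of 1] L3 by simp
  also have "\<dots> < (\<Sum>t\<in>?T. real L - 1)"
    using card_le empty_in_tiles[OF L3] L3
    by (intro sum_strict_mono_ex1[OF fT] ballI bexI[of _ "{}"]) auto
  finally have "real L * \<alpha> < real L - 1" using n(2) by (simp add: mult.assoc[symmetric] mult.commute)
  then have less: "\<alpha> < (real L - 1) / real L" using L3 by (simp add: field_simps)
  have "0 < fib (L - 1)" using L3 by (intro fib_neq_0_nat) simp
  then have pos: "0 < \<alpha>" using n(2) by (simp add: \<alpha>_def)
  have "tile_activity L \<alpha> 1"
  proof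
    show "(\<Sum>t\<in>?T. real (tile_mult L t v) * 1 ^ card t) = \<alpha> * matching_poly L 1" if "v \<in> {1..L}" for v
      using act[OF that] by (simp add: matching_poly_def)
  qed (use L3 odd pos less in auto)
  then show ?thesis by (simp only: \<alpha>_def n(1))
qed

theorem theorem3p3:
  fixes L :: nat
  assumes "3 \<le> L" and "odd L"
  shows "\<exists>\<alpha>h :: real.
    \<alpha>h \<in> feasible_densities L \<and>
    critical_distribution_uniform L \<alpha>h \<and>
    (\<forall>\<alpha>\<in>feasible_densities L. critical_distribution_uniform L \<alpha> \<longrightarrow> \<alpha> = \<alpha>h) \<and>
    \<alpha>h = 1 - ((golden_phi ^ L - golden_psi ^ L) / sqrt 5) / (golden_phi ^ L + golden_psi ^ L) \<and>
    (\<forall>\<alpha>\<in>feasible_densities L. growth_rate L \<alpha> \<le> growth_rate L \<alpha>h) \<and>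
    (\<forall>\<beta>\<in>feasible_densities L.
      (\<forall>\<alpha>\<in>feasible_densities L. growth_rate L \<alpha> \<le> growth_rate L \<beta>) \<longrightarrow> \<beta> = \<alpha>h)"
proof -
  let ?n = "real (fib (L + 1) + fib (L - 1))"
  define \<alpha>h where "\<alpha>h = 2 * real (fib (L - 1)) / ?n"
  interpret h: tile_activity L \<alpha>h 1
    unfolding \<alpha>h_def by (rule tile_activity_one[OF assms])
  have feas: "\<alpha>h \<in> feasible_densities L"
    using h.\<alpha>_pos h.\<alpha>_less by (simp add: feasible_densities_def)
  have max: "growth_rate L \<alpha>h = ln (real (card (tiles L)))"
    by (simp add: h.growth_rate_eq entropy_rate_one)
  \<comment> \<open>Uniformity, or growth no smaller than \<open>ln (card (tiles L))\<close>, forces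
    activity \<open>1\<close>, and activity \<open>1\<close> determines the density.\<close>
  have other: "(critical_distribution_uniform L \<alpha> \<longrightarrow> \<alpha> = \<alpha>h)
      \<and> growth_rate L \<alpha> \<le> growth_rate L \<alpha>h \<and> (growth_rate L \<alpha>h \<le> growth_rate L \<alpha> \<longrightarrow> \<alpha> = \<alpha>h)"
    if \<alpha>: "\<alpha> \<in> feasible_densities L" for \<alpha>
  proof -
    obtain y where "tile_activity L \<alpha> y"
      using tile_activity_exists[OF assms, of \<alpha>] \<alpha> by (auto simp: feasible_densities_def)
    then interpret a: tile_activity L \<alpha> y .
    have y1: "\<alpha> = \<alpha>h" if "y = 1" using a.density_eq_fib[OF that] by (simp only: \<alpha>h_def)
    show ?thesis
      using a.critical_distribution_uniform_iff y1 a.entropy_rate_le a.entropy_rate_less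
      by (auto simp: max a.growth_rate_eq)
  qed
  have "\<alpha>h = 1 - ((golden_phi ^ L - golden_psi ^ L) / sqrt 5) / (golden_phi ^ L + golden_psi ^ L)"
  proof -
    have "(golden_phi ^ L - golden_psi ^ L) / sqrt 5 = real (fib L)"
      using fib_closed_form[of L] by (simp add: golden_phi_def golden_psi_def)
    moreover have "golden_phi ^ L + golden_psi ^ L = ?n"
      using assms(1) by (intro lucas_closed_form) simp
    \<comment> \<open>The Lucas number minus \<open>fib L\<close> is the numerator of
      \<open>\<alpha>h\<close>, which turns the quotient into \<open>1 - fib L / ?n\<close>.\<close>
    moreover have "?n = real (fib L) + 2 * real (fib (L - 1))"
      using fib_plus_2[of "L - 1"] assms(1) by simp
    moreover have "0 < ?n" using fib_neq_0_nat[of "L + 1"] by (simp only: of_nat_0_less_iff) simp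
    ultimately show ?thesis by (simp only: \<alpha>h_def) (simp add: field_simps)
  qed
  moreover have "critical_distribution_uniform L \<alpha>h"
    using h.critical_distribution_uniform_iff by simp
  ultimately show ?thesis
    using feas other by (intro exI[of _ \<alpha>h] conjI ballI impI) blast+
qed

end
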